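(* Let $0<\beta_0<\beta_1<\infty$ and put $\rho=\frac{2-\sqrt3}{2+\sqrt3}$. With the notation given in the context, $$(R_{\theta,n}^{-1})_{2,n-1}=(-1)^{n-3}\frac{\tau_0\{\tilde\tau_{-2}[(1+2w)^2u^4-1]+\tilde\tau_{-1}\tau_1^*\}(\alpha_1-\alpha_2)}{\tau_{-1}^3(\tilde a\alpha_1+u^2\tilde b)}\left(-\frac{u}{\alpha_1}\right)^{n-2}[1+O(\rho^n)],$$ $$(R_{\theta,n}^{-1})_{n-1,n-1}=\left\{\frac{C_{7,1}}{[-(b+\tau_{-1}u)\alpha_1]^2}-\frac{C_{7,2}(\tilde a\alpha_2+u^2\tilde b)}{(\tilde a\alpha_1+u^2\tilde b)[-(b+\tau_{-1}u)\alpha_1]^2}\left(\frac{\alpha_2}{\alpha_1}\right)^{n-4}\right\}[1+O(\rho^n)],$$ $$(R_{\theta,n}^{-1})_{1,n}=(-1)^{n+1}\frac{w^2u^2(\alpha_1-\alpha_2)}{\tau_{-1}(\tilde a\alpha_1+u^2\tilde b)}\left(-\frac{u}{\alpha_1}\right)^{n-2}[1+O(\rho^n)],$$ $$(R_{\theta,n}^{-1})_{2,n}=(-1)^{n+2}\frac{\{\tilde\tau_{-2}[(1+2w)^2u^4-1]+\tilde\tau_{-1}\tau_1^*\}(\alpha_1-\alpha_2)}{\tau_{-1}^2(\tilde a\alpha_1+u^2\tilde b)}\left(-\frac{u}{\alpha_1}\right)^{n-2}[1+O(\rho^n)],$$ $$(R_{\theta,n}^{-1})_{i,n}=\frac{(-1)^{n+i}C_{6,1}\tau_{-1}^{n-i-2}[-(b+\tau_{-1}u)\alpha_1]^{i-3}}{[-(b+\tau_{-1}u)\alpha_1]^{n-2}}[1+O(\rho^n)]-\frac{(-1)^{n+i}C_{6,2}\tau_{-1}^{n-i-2}(\tilde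 a\alpha_2+u^2\tilde b)[-(b+\tau_{-1}u)\alpha_2]^{i-3}}{(\tilde a\alpha_1+u^2\tilde b)[-(b+\tau_{-1}u)\alpha_1]^{n-2}}[1+O(\rho^n)],$$ $$(R_{\theta,n}^{-1})_{n-1,n}=-\frac{C_{3,1}}{[-(b+\tau_{-1}u)\alpha_1]^2}[1+O(\rho^n)],\qquad (R_{\theta,n}^{-1})_{n,n}=-\frac{1}{(b+\tau_{-1}u)\alpha_1}[1+O(\rho^n)],$$ $$(R_{\theta,n}^{-1})_{1,1}=-\frac{1}{(b+\tau_{-1}u)\alpha_1}[1+O(\rho^n)],\qquad (R_{\theta,n}^{-1})_{2,1}=-\frac{C_{3,1}}{[-(b+\tau_{-1}u)\alpha_1]^2}[1+O(\rho^n)],$$ $$(R_{\theta,n}^{-1})_{i,1}=\frac{(-1)^{i+1}C_{6,1}\tau_{-1}^{i-3}[-(b+\tau_{-1}u)\alpha_1]^{n-i-2}}{[-(b+\tau_{-1}u)\alpha_1]^{n-2}}[1+O(\rho^n)]-\frac{(-1)^{i+1}C_{6,2}\tau_{-1}^{i-3}(\tilde a\alpha_2+u^2\tilde b)[-(b+\tau_{-1}u)\alpha_2]^{n-i-2}}{(\tilde a\alpha_1+u^2\tilde b)[-(b+\tau_{-1}u)\alpha_1]^{n-2}}[1+O(\rho^n)],$$ $$(R_{\theta,n}^{-1})_{n-1,1}=(-1)^{n+2}\frac{\{\tilde\tau_{-2}[(1+2w)^2u^4-1]+\tilde\tau_{-1}\tau_1^*\}(\alpha_1-\alpha_2)}{\tau_{-1}^2(\tilde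 a\alpha_1+u^2\tilde b)}\left(-\frac{u}{\alpha_1}\right)^{n-2}[1+O(\rho^n)],$$ as $n\to\infty$, uniformly over $\theta\in[\beta_0,\beta_1]$ and $3\le i\le n-2$.
   Context: Notation: $w=\theta/n$, $u=e^{-w}$. $R_{\theta,n}$ is the $n\times n$ matrix with $(k,l)$th element $(1+|k-l|w)u^{|k-l|}$, and $(R_{\theta,n}^{-1})_{k,l}$ is the $(k,l)$th element of its inverse. $\tau_{-1}=(w-1)u+(1+w)u^3$, $\tau_0=1-2(1+w)u^2+(1+2w)u^4$, $\tau_1^*=(1+w)u-(1+w)(1+2w)u^3$. $\hat\tau_{-2}=2\tau_{-1}u$, $\hat\tau_{-1}=(1+w)u-3(1+w)u^3+2(1+2w)u^5$, $\hat\tau_0=1-3(1+2w)u^4+2(1+3w)u^6$. $\tilde\tau_{-2}=\tau_{-1}u/2$, $\tilde\tau_{-1}=\frac12[(2w-1)u+(1+2w)u^5]$. $a=1-2u^2+u^4-2u^2w+2u^4w$, $b=2u^2-u^4+w-u^4w-1$, $\tilde a=1-u^2-2u^2w-u^2w^2$, $\tilde b=u^2+w+u^2w-1$, $$\alpha_1=\frac{-(a-2\tau_{-1}u)-\sqrt{(a-2\tau_{-1}u)^2-4\tau_{-1}u(b+\tau_{-1}u)}}{2(b+\tau_{-1}u)},\quad \alpha_2=\frac{-(a-2\tau_{-1}u)+\sqrt{(a-2\tau_{-1}u)^2-4\tau_{-1}u(b+\tau_{-1}u)}}{2(b+\tau_{-1}u)}.$$ For $l=1,2$ write $X_l=(b+\tau_{-1}u)\alpha_l-\tau_{-1}u$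 and $$C_{3,l}=\hat\tau_{-1}+\frac{\hat\tau_{-2}u[w(1-4u^2+3u^4)+(1-u^2)^2]}{X_l}+\frac{w\tau_{-1}u^2\hat\tau_{-2}(1-u^2)^2}{X_l^2},$$ $$C_{6,l}=\hat\tau_{-1}\tilde\tau_{-1}-\hat\tau_0\tilde\tau_{-2}+\frac{\hat\tau_{-2}u\tilde\tau_{-1}[w(1-4u^2+3u^4)+(1-u^2)^2]}{X_l}-\frac{\hat\tau_{-2}\tilde\tau_{-2}u^2[w(2-6u^2+4u^4)+(1-u^2)^2]}{X_l}+\frac{w\tau_{-1}u^2\hat\tau_{-2}(\tilde\tau_{-1}-u\tilde\tau_{-2})(1-u^2)^2}{X_l^2},$$ $$C_{7,l}=\frac{\hat\tau_{-2}u^2[w(2-6u^2+4u^4)+(1-u^2)^2]}{X_l}+\frac{w\tau_{-1}\hat\tau_{-2}u^3(1-u^2)^2}{X_l^2}+\hat\tau_0.$$ *)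

theory Defs
  imports Complex_Main "Jordan_Normal_Form.Gauss_Jordan_Elimination"
begin

definition R_mat :: "real \<Rightarrow> nat \<Rightarrow> real mat" where
  "R_mat \<theta> n = mat n n (\<lambda>(k, l).
     let w = \<theta> / real n; d = nat \<bar>int k - int l\<bar>
     in (1 + real d * w) * exp (- w) ^ d)"

text \<open>
  Matrices of the library are indexed from 0; the arguments \<open>k\<close> and \<open>l\<close> below run from 1 to \<open>n\<close>.
  The entry is meaningful only where \<open>R_mat \<theta> n\<close> is invertible.
\<close>
definition R_inv :: "real \<Rightarrow> nat \<Rightarrow> nat \<Rightarrow> nat \<Rightarrow> real" where
  "R_inv \<theta> n k l = the (mat_inverse (R_mat \<theta> n)) $$ (k - 1, l - 1)"

definition rho :: real where
  "rho = (2 - sqrt 3) / (2 + sqrt 3)"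

text \<open>
  All quantities below are functions of \<open>w = \<theta> / n\<close>. A suffix \<open>mj\<close> stands for the subscript \<open>- j\<close>,
  the prefixes \<open>h\<close> and \<open>t\<close> for a hat and a tilde, and \<open>tau_1s\<close> for the starred quantity.
\<close>
context
  fixes w :: real
begin

definition uw :: real where "uw = exp (- w)"

definition tau_m1 :: real where
  "tau_m1 = (w - 1) * uw + (1 + w) * uw ^ 3"
definition tau_0 :: real where
  "tau_0 = 1 - 2 * (1 + w) * uw ^ 2 + (1 + 2 * w) * uw ^ 4"
definition tau_1s :: real where
  "tau_1s = (1 + w) * uw - (1 + w) * (1 + 2 * w) * uw ^ 3"

definition htau_m2 :: real where
  "htau_m2 = 2 * tau_m1 * uw"
definition htau_m1 :: real where
  "htau_m1 = (1 + w) * uw - 3 * (1 + w) * uw ^ 3 + 2 * (1 + 2 * w) * uw ^ 5"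
definition htau_0 :: real where
  "htau_0 = 1 - 3 * (1 + 2 * w) * uw ^ 4 + 2 * (1 + 3 * w) * uw ^ 6"

definition ttau_m2 :: real where
  "ttau_m2 = tau_m1 * uw / 2"
definition ttau_m1 :: real where
  "ttau_m1 = 1 / 2 * ((2 * w - 1) * uw + (1 + 2 * w) * uw ^ 5)"

definition coef_a :: real where
  "coef_a = 1 - 2 * uw ^ 2 + uw ^ 4 - 2 * uw ^ 2 * w + 2 * uw ^ 4 * w"
definition coef_b :: real where
  "coef_b = 2 * uw ^ 2 - uw ^ 4 + w - uw ^ 4 * w - 1"
definition tcoef_a :: real where
  "tcoef_a = 1 - uw ^ 2 - 2 * uw ^ 2 * w - uw ^ 2 * w ^ 2"
definition tcoef_b :: real where
  "tcoef_b = uw ^ 2 + w + uw ^ 2 * w - 1"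

definition alpha1 :: real where
  "alpha1 = (- (coef_a - 2 * tau_m1 * uw)
      - sqrt ((coef_a - 2 * tau_m1 * uw) ^ 2 - 4 * tau_m1 * uw * (coef_b + tau_m1 * uw)))
    / (2 * (coef_b + tau_m1 * uw))"
definition alpha2 :: real where
  "alpha2 = (- (coef_a - 2 * tau_m1 * uw)
      + sqrt ((coef_a - 2 * tau_m1 * uw) ^ 2 - 4 * tau_m1 * uw * (coef_b + tau_m1 * uw)))
    / (2 * (coef_b + tau_m1 * uw))"

text \<open>The second index \<open>l\<close> of \<open>X\<close> and of the constants \<open>C\<close> is replaced by the root \<open>\<alpha>\<close> itself.\<close>

definition X_of :: "real \<Rightarrow> real" where
  "X_of \<alpha> = (coef_b + tau_m1 * uw) * \<alpha> - tau_m1 * uw"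

definition C3 :: "real \<Rightarrow> real" where
  "C3 \<alpha> = htau_m1
     + htau_m2 * uw * (w * (1 - 4 * uw ^ 2 + 3 * uw ^ 4) + (1 - uw ^ 2) ^ 2) / X_of \<alpha>
     + w * tau_m1 * uw ^ 2 * htau_m2 * (1 - uw ^ 2) ^ 2 / (X_of \<alpha>) ^ 2"

definition C6 :: "real \<Rightarrow> real" where
  "C6 \<alpha> = htau_m1 * ttau_m1 - htau_0 * ttau_m2
     + htau_m2 * uw * ttau_m1 * (w * (1 - 4 * uw ^ 2 + 3 * uw ^ 4) + (1 - uw ^ 2) ^ 2) / X_of \<alpha>
     - htau_m2 * ttau_m2 * uw ^ 2 * (w * (2 - 6 * uw ^ 2 + 4 * uw ^ 4) + (1 - uw ^ 2) ^ 2) / X_of \<alpha>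
     + w * tau_m1 * uw ^ 2 * htau_m2 * (ttau_m1 - uw * ttau_m2) * (1 - uw ^ 2) ^ 2 / (X_of \<alpha>) ^ 2"

definition C7 :: "real \<Rightarrow> real" where
  "C7 \<alpha> = htau_m2 * uw ^ 2 * (w * (2 - 6 * uw ^ 2 + 4 * uw ^ 4) + (1 - uw ^ 2) ^ 2) / X_of \<alpha>
     + w * tau_m1 * htau_m2 * uw ^ 3 * (1 - uw ^ 2) ^ 2 / (X_of \<alpha>) ^ 2
     + htau_0"

end

end

theory Submission
  imports Defs "Jordan_Normal_Form.Determinant"
begin

text \<open>
  Put \<open>s = b + \<tau>\<^sub>-\<^sub>1 u\<close>. Then \<open>s\<close> is the constant \<open>tcoef_b\<close>, \<open>\<tau>\<^sub>-\<^sub>1 = u s\<close>, and \<open>\<alpha>\<^sub>1 = u p\<close>,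
  \<open>\<alpha>\<^sub>2 = u q\<close>, where \<open>p\<close> and \<open>q = 1 / p\<close> are the two roots of
  \<open>u s (z\<^sup>2 + 1) + (1 - u\<^sup>4 - 4 w u\<^sup>2) z\<close>. Up to a factor \<open>z\<close>, this polynomial is the numerator
  of the symbol \<open>\<Sum>\<^sub>d (1 + \<bar>d\<bar> w) u\<^bsup>\<bar>d\<bar>\<^esup> z\<^sup>d\<close> of the bi-infinite Toeplitz matrix, so that
  matrix formally annihilates the sequences \<open>p\<^sup>k\<close> and \<open>q\<^sup>k\<close>.

  Cutting \<open>p\<^sup>k\<close> off at \<open>1\<close> and \<open>n\<close> leaves on each side an error of the form
  \<open>(A + B k) u\<^sup>k\<close>, counted from that end. The kernel produces every such sequence from two point
  masses, so a change of the entries \<open>1, 2\<close> and \<open>n - 1, n\<close> removes the error everywhere except in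
  the rows \<open>1\<close> and \<open>n\<close> (\<open>kern_sum_mode\<close>). The modes obtained from \<open>p\<close> and from \<open>q\<close> thus are mapped
  to combinations of \<open>e\<^sub>1\<close> and \<open>e\<^sub>n\<close>, and solving a system of two equations gives the first and
  the last column of the inverse exactly (\<open>solve_boundary_system\<close>). The inverse exists: a null vector
  of the symmetric matrix is orthogonal to its range, which contains \<open>e\<^sub>1\<close> and \<open>e\<^sub>n\<close>, and by the
  triangular action of the stencils \<open>(u\<^sup>2, -2u, 1)\<close> all other unit vectors
  (\<open>kern_sum_eq_0_imp\<close>). The last stencil is mapped to \<open>\<tau>\<^sub>-\<^sub>1 e\<^bsub>n-1\<^esub> + \<tau>\<^sub>0 e\<^sub>n\<close>, which
  reduces column \<open>n - 1\<close> to column \<open>n\<close>.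

  The determinant of the system of two equations is \<open>1 - \<delta>\<close> up to a factor, with
  \<open>\<delta> = q\<^bsup>2n+2\<^esup> ((1 - u p) / (1 - u q))\<^sup>4\<close>. After the constants have been simplified (for instance
  \<open>C\<^sub>6\<^sub>,\<^sub>l = (u s (1 - \<alpha>\<^sub>l))\<^sup>2\<close>), the asserted leading terms are the exact entries multiplied by
  \<open>1 - \<delta>\<close>; in the four entries \<open>(1,1)\<close>, \<open>(n,n)\<close>, \<open>(2,1)\<close>, \<open>(n-1,n)\<close> one further term of the
  order of \<open>q\<^sup>2\<^sup>n\<close> relative to the leading one has been dropped. Hence everything follows from
  \<open>q\<^sup>2 \<le> \<rho>\<close>. As \<open>\<rho> = (2 - \<surd>3)\<^sup>2\<close>, this says \<open>- (p + q) \<ge> 4\<close>, and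
  \<open>- (p + q) = (sinh 2w - 2w) / (w cosh w - sinh w)\<close> is at least \<open>4\<close> for every \<open>w > 0\<close>
  (\<open>sinh_double_bound\<close>). This bound is free of \<open>w\<close>, and so is the resulting constant
  \<open>2 / \<rho>\<^sup>3\<close> of the error terms.
\<close>

section \<open>Convolution with the kernel\<close>

definition kern :: "real \<Rightarrow> real \<Rightarrow> nat \<Rightarrow> nat \<Rightarrow> real" where
  "kern w u k l = (1 + real (nat \<bar>int k - int l\<bar>) * w) * u ^ nat \<bar>int k - int l\<bar>"

lemma kern_above: "l \<le> k \<Longrightarrow> kern w u k l = (1 + real (k - l) * w) * u ^ (k - l)"
  by (simp add: kern_def nat_diff_distrib')

lemma kern_commute: "kern w u k l = kern w u l k"
  by (simp add: kern_def abs_minus_commute)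

lemma kern_below: "k \<le> l \<Longrightarrow> kern w u k l = (1 + real (l - k) * w) * u ^ (l - k)"
  by (subst kern_commute) (rule kern_above)

lemma kern_reflect:
  assumes "k \<le> n + 1" "l \<le> n + 1"
  shows "kern w u (n + 1 - k) (n + 1 - l) = kern w u k l"
  using assms by (cases k l rule: le_cases) (simp_all add: kern_above kern_below)

definition kern_sum :: "real \<Rightarrow> real \<Rightarrow> nat \<Rightarrow> (nat \<Rightarrow> real) \<Rightarrow> nat \<Rightarrow> real" where
  "kern_sum w u n x k = (\<Sum>l = 1..n. kern w u k l * x l)"

lemma kern_sum_add:
  "kern_sum w u n (\<lambda>l. x l + y l) k = kern_sum w u n x k + kern_sum w u n y k"
  by (simp add: kern_sum_def distrib_left sum.distrib)

lemma kern_sum_cmult: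
  "kern_sum w u n (\<lambda>l. c * x l) k = c * kern_sum w u n x k"
  by (simp add: kern_sum_def sum_distrib_left mult_ac)

lemma kern_sum_reflect:
  assumes "1 \<le> k" "k \<le> n"
  shows "kern_sum w u n (\<lambda>l. x (n + 1 - l)) k = kern_sum w u n x (n + 1 - k)"
  unfolding kern_sum_def
proof (rule sum.reindex_bij_witness[of _ "\<lambda>l. n + 1 - l" "\<lambda>l. n + 1 - l"], goal_cases)
  case (5 l)
  then show ?case using kern_reflect[of k n l] assms by simp
qed auto

lemma kern_sum_two:
  assumes "2 \<le> n" "\<And>l. l \<ge> 3 \<Longrightarrow> x l = 0"
  shows "kern_sum w u n x k = kern w u k 1 * x 1 + kern w u k 2 * x 2"
proof -
  have "kern_sum w u n x k = (\<Sum>l\<in>{1,2}. kern w u k l * x l)"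
    unfolding kern_sum_def by (rule sum.mono_neutral_right) (use assms in \<open>auto simp: Suc_le_eq numeral_eq_Suc not_less less_Suc_eq\<close>)
  then show ?thesis by simp
qed

lemma kern_sum_three:
  assumes "1 \<le> j" "j + 2 \<le> n" "\<And>l. l \<notin> {j, j + 1, j + 2} \<Longrightarrow> x l = 0"
  shows "kern_sum w u n x k
    = kern w u k j * x j + kern w u k (j + 1) * x (j + 1) + kern w u k (j + 2) * x (j + 2)"
proof -
  have "kern_sum w u n x k = (\<Sum>l\<in>{j, j + 1, j + 2}. kern w u k l * x l)"
    unfolding kern_sum_def by (rule sum.mono_neutral_right) (use assms in auto)
  then show ?thesis by simp
qed

lemma arith_geometric_sum:
  fixes w y :: real
  assumes "y \<noteq> 1"
  shows "(\<Sum>d<m. (1 + real d * w) * y ^ d)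
    = 1 / (1 - y) + w * y / (1 - y)\<^sup>2 - y ^ m * ((1 + real m * w) / (1 - y) + w * y / (1 - y)\<^sup>2)"
proof (induction m)
  case (Suc m)
  have "(1 + real m * w) * y ^ m
    = y ^ m * ((1 + real m * w) / (1 - y) + w * y / (1 - y)\<^sup>2)
      - y ^ Suc m * ((1 + real (Suc m) * w) / (1 - y) + w * y / (1 - y)\<^sup>2)"
    using assms by (simp add: divide_simps) (simp add: algebra_simps power2_eq_square)
  with Suc show ?case by simp
qed simp

text \<open>
  Splitting the sum at \<open>l = k\<close> turns it into two one-sided series in the distance \<open>d = \<bar>k - l\<bar>\<close>, with
  ratios \<open>u q\<close> to the left and \<open>u p\<close> to the right. The summand \<open>-1\<close> corrects for \<open>d = 0\<close>, which both
  series contain.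
\<close>
lemma kern_sum_power:
  fixes p q :: real
  assumes "p * q = 1" "1 \<le> k" "k \<le> n"
  shows "kern_sum w u n (\<lambda>l. p ^ l) k
    = p ^ k * ((\<Sum>d<k. (1 + real d * w) * (u * q) ^ d)
        + (\<Sum>d<n + 1 - k. (1 + real d * w) * (u * p) ^ d) - 1)"
proof -
  have p: "p ^ l = p ^ k * q ^ (k - l)" if "l \<le> k" for l
  proof -
    have "p ^ k * q ^ (k - l) = p ^ l * (p * q) ^ (k - l)"
      using that by (simp add: power_mult_distrib flip: power_add mult.assoc)
    then show ?thesis by (simp add: assms)
  qed
  have "kern_sum w u n (\<lambda>l. p ^ l) k
    = (\<Sum>l\<in>{1..k}. kern w u k l * p ^ l) + (\<Sum>l\<in>{k<..n}. kern w u k l * p ^ l)"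
    unfolding kern_sum_def using assms
    by (subst sum.union_disjoint[symmetric]) (simp_all add: ivl_disj_un_two(8) ivl_disj_int_two(8))
  also have "(\<Sum>l\<in>{1..k}. kern w u k l * p ^ l) = (\<Sum>d<k. p ^ k * ((1 + real d * w) * (u * q) ^ d))"
  proof (rule sum.reindex_bij_witness[of _ "\<lambda>d. k - d" "\<lambda>l. k - l"], goal_cases)
    case (5 l)
    then have "l \<le> k" by simp
    then show ?case by (simp add: kern_above p[of l] power_mult_distrib)
  qed auto
  also have "\<dots> = p ^ k * (\<Sum>d<k. (1 + real d * w) * (u * q) ^ d)"
    by (simp add: sum_distrib_left)
  also have "(\<Sum>l\<in>{k<..n}. kern w u k l * p ^ l)
    = (\<Sum>d\<in>{1..<n + 1 - k}. p ^ k * ((1 + real d * w) * (u * p) ^ d))"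
    by (rule sum.reindex_bij_witness[of _ "\<lambda>d. k + d" "\<lambda>l. l - k"])
       (auto simp: kern_below power_mult_distrib simp flip: power_add)
  also have "\<dots> = p ^ k * (\<Sum>d\<in>{1..<n + 1 - k}. (1 + real d * w) * (u * p) ^ d)"
    by (simp add: sum_distrib_left)
  also have "(\<Sum>d\<in>{1..<n + 1 - k}. (1 + real d * w) * (u * p) ^ d)
    = (\<Sum>d<n + 1 - k. (1 + real d * w) * (u * p) ^ d) - 1"
    using assms by (simp add: lessThan_atLeast0 sum.atLeast_Suc_lessThan)
  finally show ?thesis by (simp add: algebra_simps)
qed

section \<open>The modes belonging to the two zeros of the symbol\<close>

text \<open>
  The assumptions are symmetric under the exchange of \<open>p\<close> and \<open>q\<close>, so each fact about the left end
  yields, by reflection, one about the right end.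
\<close>
locale root_pair =
  fixes w u p q :: real
  assumes w_pos: "0 < w" and u_pos: "0 < u"
    and prod: "p * q = 1" and p_neg: "p < 0"
    and char: "u * (u\<^sup>2 + w + u\<^sup>2 * w - 1) * (p + q) = 4 * w * u\<^sup>2 + u ^ 4 - 1"
begin

lemma q_neg: "q < 0"
  using prod p_neg by (smt (verit) zero_less_mult_iff)

lemma swap: "root_pair w u q p"
  using w_pos u_pos prod q_neg char by unfold_locales (auto simp: mult.commute add.commute)

definition s :: real where "s = u\<^sup>2 + w + u\<^sup>2 * w - 1"

lemma one_minus_uq_gt_1: "1 - u * q > 1"
  using u_pos q_neg by (simp add: mult_pos_neg)

text \<open>
  In the row sum of a power, the two one-sided series, extended to infinity, contribute the
  left-hand side. It counts the distance \<open>0\<close> twice, so subtracting \<open>1\<close> gives the value of the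
  symbol at \<open>p\<close>, which is zero by the equation of \<open>p\<close>.
\<close>
lemma symbol_vanishes:
  "1 / (1 - u * q) + w * (u * q) / (1 - u * q)\<^sup>2 + (1 / (1 - u * p) + w * (u * p) / (1 - u * p)\<^sup>2) = 1"
proof -
  interpret sw: root_pair w u q p by (rule swap)
  have nz: "1 - u * p \<noteq> 0" "1 - u * q \<noteq> 0" using one_minus_uq_gt_1 sw.one_minus_uq_gt_1 by auto
  have outer: "(1 - u * p) + (1 - u * q) - (1 - u * p) * (1 - u * q) = 1 - u\<^sup>2"
    using prod by (simp add: algebra_simps power2_eq_square)
  have "(1 - u * p) * (1 - u * q) = 1 + u\<^sup>2 * (p * q) - u * (p + q)"
    "u * q * (1 - u * p)\<^sup>2 + u * p * (1 - u * q)\<^sup>2 = (p + q) * u * (1 + u\<^sup>2 * (p * q)) - 4 * u\<^sup>2 * (p * q)"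
    by (simp_all add: algebra_simps power2_eq_square)
  then have inner: "(1 - u * p) * (1 - u * q) = 1 + u\<^sup>2 - u * (p + q)"
    "u * q * (1 - u * p)\<^sup>2 + u * p * (1 - u * q)\<^sup>2 = u * (p + q) * (1 + u\<^sup>2) - 4 * u\<^sup>2"
    by (simp_all add: prod mult_ac)
  have zero: "(1 - u * p) * (1 - u * q) * (1 - u\<^sup>2)
    + w * (u * q * (1 - u * p)\<^sup>2 + u * p * (1 - u * q)\<^sup>2) = 0"
    unfolding inner using char by (simp add: algebra_simps power2_eq_square power4_eq_xxxx)
  have "1 / y + w * (u * q) / y\<^sup>2 + (1 / x + w * (u * p) / x\<^sup>2) - 1
    = (x * y * (x + y - x * y) + w * (u * q * x\<^sup>2 + u * p * y\<^sup>2)) / (x\<^sup>2 * y\<^sup>2)"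
    if "x \<noteq> 0" "y \<noteq> 0" for x y :: real
    using that by (simp add: divide_simps) (simp add: algebra_simps power2_eq_square)
  from this[OF nz] show ?thesis unfolding outer zero by simp
qed

text \<open>
  The formal contribution of the entries at \<open>\<dots>, -1, 0\<close> to row \<open>k\<close>, which is lost when the sequence
  \<open>p\<^sup>k\<close> is cut off on the left.
\<close>
definition tail :: "nat \<Rightarrow> real" where
  "tail k = u ^ k * ((1 + real k * w) / (1 - u * q) + w * (u * q) / (1 - u * q)\<^sup>2)"

text \<open>
  The two point masses whose image is \<open>tail\<close> in every row from the second on. They are obtained by
  matching the coefficients of \<open>u\<^sup>k\<close> and \<open>k u\<^sup>k\<close>.
\<close>
definition edge :: "nat \<Rightarrow> real" where
  "edge k = (if k = 1 then u * (2 - u * q) / (1 - u * q)\<^sup>2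
     else if k = 2 then - u\<^sup>2 / (1 - u * q)\<^sup>2 else 0)"

lemma kern_sum_edge:
  assumes "2 \<le> n" "1 \<le> k"
  shows "kern_sum w u n edge k = tail k - (if k = 1 then u * s / (1 - u * q)\<^sup>2 else 0)"
proof -
  have a: "1 - u * q \<noteq> 0" using one_minus_uq_gt_1 by auto
  have *: "kern_sum w u n edge k = kern w u k 1 * edge 1 + kern w u k 2 * edge 2"
    using assms by (intro kern_sum_two) (auto simp: edge_def)
  show ?thesis
  proof (cases "k = 1")
    case True
    then show ?thesis unfolding * tail_def using a
      by (simp add: edge_def kern_above kern_below divide_simps s_def)
        (simp add: algebra_simps power2_eq_square)
  next
    case False
    then obtain j where k: "k = j + 2" using assms by (metis Suc_1 add.commute le_Suc_ex le_antisym not_less_eq_eq)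
    show ?thesis unfolding * tail_def using a unfolding k
      by (simp add: edge_def kern_above divide_simps)
        (simp add: algebra_simps power2_eq_square)
  qed
qed

lemma kern_sum_root_power:
  assumes "1 \<le> k" "k \<le> n"
  shows "kern_sum w u n (\<lambda>l. p ^ l) k
    = - tail k - p ^ (n + 1) * root_pair.tail w u p (n + 1 - k)"
proof -
  interpret sw: root_pair w u q p by (rule swap)
  have nz: "u * q \<noteq> 1" "u * p \<noteq> 1" using one_minus_uq_gt_1 sw.one_minus_uq_gt_1 by auto
  have pk: "p ^ k * (u * q) ^ k = u ^ k"
    by (metis mult.left_commute mult.right_neutral power_mult_distrib prod)
  have "p ^ k * (u * p) ^ (n + 1 - k) = p ^ (k + (n + 1 - k)) * u ^ (n + 1 - k)"
    by (simp only: power_mult_distrib power_add mult_ac)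
  then have pn: "p ^ k * (u * p) ^ (n + 1 - k) = p ^ (n + 1) * u ^ (n + 1 - k)"
    using assms by simp
  let ?H = "(1 + real k * w) / (1 - u * q) + w * (u * q) / (1 - u * q)\<^sup>2"
  let ?G = "(1 + real (n + 1 - k) * w) / (1 - u * p) + w * (u * p) / (1 - u * p)\<^sup>2"
  have "kern_sum w u n (\<lambda>l. p ^ l) k
    = p ^ k * ((1 / (1 - u * q) + w * (u * q) / (1 - u * q)\<^sup>2
        + (1 / (1 - u * p) + w * (u * p) / (1 - u * p)\<^sup>2)) - 1
      - (u * q) ^ k * ?H - (u * p) ^ (n + 1 - k) * ?G)"
    unfolding kern_sum_power[OF prod assms] arith_geometric_sum[OF nz(1)] arith_geometric_sum[OF nz(2)]
    by (simp only: algebra_simps)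
  also have "\<dots> = - (p ^ k * (u * q) ^ k * ?H) - p ^ k * (u * p) ^ (n + 1 - k) * ?G"
    unfolding symbol_vanishes by (simp only: algebra_simps)
  also have "\<dots> = - tail k - p ^ (n + 1) * sw.tail (n + 1 - k)"
    unfolding pk pn tail_def sw.tail_def by (simp only: mult.assoc)
  finally show ?thesis .
qed

definition mode :: "nat \<Rightarrow> nat \<Rightarrow> real" where
  "mode n k = p ^ k + edge k + p ^ (n + 1) * root_pair.edge u p (n + 1 - k)"

text \<open>
  The value that the edge correction fails to cancel in its own outermost row: for row \<open>1\<close> the mass
  at position \<open>2\<close> lies to the right, where the kernel is not the continuation of \<open>(1 + d w) u\<^sup>d\<close>.
\<close>
definition leak :: real where
  "leak = - u * s / (1 - u * q)\<^sup>2"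

theorem kern_sum_mode:
  assumes "2 \<le> n" "1 \<le> k" "k \<le> n"
  shows "kern_sum w u n (mode n) k
    = (if k = 1 then leak else 0) + (if k = n then p ^ (n + 1) * root_pair.leak w u p else 0)"
proof -
  interpret sw: root_pair w u q p by (rule swap)
  have "kern_sum w u n (mode n) k
    = kern_sum w u n (\<lambda>l. p ^ l) k + kern_sum w u n edge k
      + p ^ (n + 1) * kern_sum w u n sw.edge (n + 1 - k)"
    unfolding mode_def kern_sum_add kern_sum_cmult
    using kern_sum_reflect[of k n w u sw.edge] assms by simp
  also have "\<dots> = - (if k = 1 then u * s / (1 - u * q)\<^sup>2 else 0)
     - p ^ (n + 1) * (if n + 1 - k = 1 then u * sw.s / (1 - u * p)\<^sup>2 else 0)"
    using assms by (simp add: kern_sum_root_power kern_sum_edge sw.kern_sum_edge algebra_simps)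
  also have "\<dots> = (if k = 1 then leak else 0) + (if k = n then p ^ (n + 1) * sw.leak else 0)"
    using assms by (auto simp: leak_def sw.leak_def)
  finally show ?thesis .
qed

end

section \<open>The zeros in terms of the scale parameter\<close>

lemma sinh_gt_self: "sinh x > x" if "x > 0" for x :: real
proof -
  have "sinh 0 - 0 < sinh x - x"
  proof (rule DERIV_pos_imp_increasing_open[OF that])
    fix y :: real assume "0 < y"
    then have "cosh y - 1 > 0"
      using cosh_real_ge_1[of y] cosh_real_one_iff[of y] by linarith
    then show "\<exists>D. ((\<lambda>x. sinh x - x) has_real_derivative D) (at y) \<and> D > 0"
      by (intro exI conjI) (auto intro!: derivative_eq_intros)
  qed (auto intro!: continuous_intros)
  then show ?thesis by simp
qed

lemma sinh_less_mult_cosh: "sinh x < x * cosh x" if "x > 0" for x :: real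
proof -
  have "0 * cosh 0 - sinh 0 < x * cosh x - sinh x"
    by (rule DERIV_pos_imp_increasing_open[OF that])
       (auto intro!: exI[of _ "_ * sinh _"] derivative_eq_intros continuous_intros mult_pos_pos)
  then show ?thesis by simp
qed

text \<open>
  The difference of both sides vanishes at \<open>0\<close> and has derivative \<open>4 sinh x (sinh x - x)\<close>.
\<close>
lemma sinh_double_bound:
  fixes x :: real
  assumes "x > 0"
  shows "4 * (x * cosh x - sinh x) \<le> sinh (2 * x) - 2 * x"
proof -
  let ?F = "\<lambda>x::real. sinh (2 * x) - 2 * x - 4 * (x * cosh x - sinh x)"
  have "?F 0 \<le> ?F x"
  proof (rule DERIV_nonneg_imp_nondecreasing[where f = ?F])
    fix y :: real assume y: "0 \<le> y" "y \<le> x"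
    have "y \<le> sinh y" using sinh_gt_self[of y] y by (cases "y = 0") auto
    then have "0 \<le> 4 * (sinh y * (sinh y - y))" using y by simp
    also have "\<dots> = cosh (2 * y) * 2 - 2 - 4 * (y * sinh y)"
      using cosh_double[of y] cosh_square_eq[of y] by (simp add: algebra_simps power2_eq_square)
    finally show "\<exists>D. (?F has_real_derivative D) (at y) \<and> 0 \<le> D"
      by (intro exI conjI) (auto intro!: derivative_eq_intros simp: mult_ac)
  qed (use assms in simp)
  then show ?thesis by simp
qed

lemma uw_cosh_sinh: "uw w * cosh w = (1 + (uw w)\<^sup>2) / 2" "uw w * sinh w = (1 - (uw w)\<^sup>2) / 2"
    "(uw w)\<^sup>2 * sinh (2 * w) = (1 - (uw w) ^ 4) / 2"
proof -
  have [simp]: "exp w * exp (- w) = 1" by (simp flip: exp_add)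
  show 1: "uw w * cosh w = (1 + (uw w)\<^sup>2) / 2" "uw w * sinh w = (1 - (uw w)\<^sup>2) / 2"
    by (simp_all add: uw_def cosh_field_def sinh_field_def field_simps power2_eq_square)
  have "(uw w)\<^sup>2 * sinh (2 * w) = 2 * (uw w * sinh w) * (uw w * cosh w)"
    by (simp add: sinh_double power2_eq_square)
  then show "(uw w)\<^sup>2 * sinh (2 * w) = (1 - (uw w) ^ 4) / 2"
    unfolding 1 by (simp add: field_simps power2_eq_square power4_eq_xxxx)
qed

lemma tcoef_b_pos: "tcoef_b w > 0" if "w > 0"
proof -
  have "tcoef_b w = 2 * (w * (uw w * cosh w) - uw w * sinh w)"
    unfolding uw_cosh_sinh tcoef_b_def by (simp add: field_simps)
  also have "\<dots> = 2 * uw w * (w * cosh w - sinh w)" by (simp add: algebra_simps)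
  also have "\<dots> > 0" using sinh_less_mult_cosh[OF that] by (simp add: uw_def)
  finally show ?thesis .
qed

text \<open>
  This says that the two roots have sum at most \<open>-4\<close>: up to a common factor \<open>2 u\<^sup>2\<close> the left-hand side is
  \<open>4 (w cosh w - sinh w)\<close> and the right-hand side is \<open>sinh 2w - 2w\<close>.
\<close>
lemma trace_bound: "4 * (uw w * tcoef_b w) \<le> 1 - uw w ^ 4 - 4 * w * (uw w)\<^sup>2" if "w > 0"
proof -
  have "uw w * tcoef_b w = 2 * uw w * (w * (uw w * cosh w) - uw w * sinh w)"
    unfolding uw_cosh_sinh tcoef_b_def by (simp add: field_simps)
  then have "4 * (uw w * tcoef_b w) = 2 * (uw w)\<^sup>2 * (4 * (w * cosh w - sinh w))"
    by (simp add: algebra_simps power2_eq_square)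
  also have "\<dots> \<le> 2 * (uw w)\<^sup>2 * (sinh (2 * w) - 2 * w)"
    using sinh_double_bound[OF that] by (intro mult_left_mono) auto
  also have "\<dots> = 2 * ((uw w)\<^sup>2 * sinh (2 * w)) - 4 * w * (uw w)\<^sup>2"
    by (simp add: algebra_simps)
  also have "\<dots> = 1 - uw w ^ 4 - 4 * w * (uw w)\<^sup>2"
    unfolding uw_cosh_sinh by simp
  finally show ?thesis .
qed

lemma tau_m1_eq: "tau_m1 w = uw w * tcoef_b w"
  by (simp add: tau_m1_def tcoef_b_def algebra_simps power2_eq_square power3_eq_cube)

lemma leading_coef_eq: "coef_b w + tau_m1 w * uw w = tcoef_b w"
  by (simp add: coef_b_def tau_m1_def tcoef_b_def algebra_simps power2_eq_square power3_eq_cube power4_eq_xxxx)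

lemma middle_coef_eq: "coef_a w - 2 * tau_m1 w * uw w = 1 - uw w ^ 4 - 4 * w * (uw w)\<^sup>2"
  by (simp add: coef_a_def tau_m1_def algebra_simps power2_eq_square power3_eq_cube power4_eq_xxxx)

lemma alpha_numerator_eq:
  "ttau_m2 w * ((1 + 2 * w) ^ 2 * uw w ^ 4 - 1) + ttau_m1 w * tau_1s w = w\<^sup>2 * (uw w)\<^sup>2 * coef_a w"
proof -
  have *: "x / 2 * E + 1 / 2 * y * z = (x * E + y * z) / 2" for x y z E :: real
    by simp
  show ?thesis
    unfolding ttau_m2_def ttau_m1_def tau_1s_def tau_m1_def coef_a_def * divide_eq_eq
    by (simp add: algebra_simps eval_nat_numeral)
qed

text \<open>
  The discriminant is nonnegative and \<open>\<bar>q\<bar> + 1 / \<bar>q\<bar> \<ge> 4\<close> by \<open>trace_bound\<close>; as \<open>\<bar>q\<bar> \<le> 1\<close>, this forces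
  \<open>\<bar>q\<bar> \<le> 2 - \<surd>3\<close>, and \<open>\<rho>\<close> is the square of that number.
\<close>
lemma alpha_root_pair:
  assumes w: "w > 0"
  defines "p \<equiv> alpha1 w / uw w" and "q \<equiv> alpha2 w / uw w"
  shows "root_pair w (uw w) p q" "p \<le> q" "q\<^sup>2 \<le> rho"
proof -
  define u where "u = uw w"
  define s where "s = tcoef_b w"
  define A where "A = 1 - u ^ 4 - 4 * w * u\<^sup>2"
  define r where "r = sqrt (A\<^sup>2 - 4 * (u * s)\<^sup>2)"
  have u: "u > 0" by (simp add: u_def uw_def)
  have s: "s > 0" unfolding s_def by (rule tcoef_b_pos[OF w])
  have us: "u * s > 0" using u s by simp
  have A: "A \<ge> 4 * (u * s)" using trace_bound[OF w] by (simp add: A_def u_def s_def)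
  have disc: "(A\<^sup>2 - 4 * tau_m1 w * uw w * s) = A\<^sup>2 - 4 * (u * s)\<^sup>2"
    by (simp add: tau_m1_eq u_def s_def power2_eq_square)
  have p: "p = (- A - r) / (2 * (u * s))" and q: "q = (- A + r) / (2 * (u * s))"
    unfolding p_def q_def alpha1_def alpha2_def leading_coef_eq middle_coef_eq
    by (simp_all add: A_def r_def u_def s_def tau_m1_eq power2_eq_square mult_ac)
  have "(2 * (u * s))\<^sup>2 \<le> A\<^sup>2" using A us by (intro power_mono) auto
  then have r2: "r\<^sup>2 = A\<^sup>2 - 4 * (u * s)\<^sup>2" and r0: "r \<ge> 0"
    unfolding r_def by (simp_all add: power_mult_distrib)
  have pq: "p * q = 1"
  proof -
    have "p * q = (A\<^sup>2 - r\<^sup>2) / (4 * (u * s)\<^sup>2)"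
      unfolding p q by (simp add: power2_eq_square algebra_simps)
    also have "\<dots> = 1" unfolding r2 using u s by simp
    finally show ?thesis .
  qed
  have sum: "u * s * (p + q) = - A"
    unfolding p q add_divide_distrib[symmetric] using u s by simp
  have neg: "p < 0" unfolding p using A us r0 by (intro divide_neg_pos) auto
  show "root_pair w (uw w) p q"
    using w u pq neg sum by unfold_locales (simp_all add: u_def A_def s_def tcoef_b_def)
  show le: "p \<le> q" unfolding p q using us r0 by (intro divide_right_mono) auto
  have q0: "q < 0" using pq neg by (smt (verit) zero_less_mult_iff)
  define y where "y = - q"
  have y0: "y > 0" using q0 by (simp add: y_def)
  have "y\<^sup>2 \<le> p * q" using le q0 by (simp add: y_def power2_eq_square mult_right_mono_neg)
  then have y1: "y \<le> 1" unfolding pq using y0 by (simp add: power_le_one_iff)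
  have "u * s * 4 \<le> u * s * (- (p + q))" using A sum by (simp add: algebra_simps)
  then have "4 \<le> - (p + q)" using us by (rule mult_left_le_imp_le)
  then have "4 * y \<le> - (p + q) * y" using y0 by (intro mult_right_mono) auto
  also have "\<dots> = 1 + y\<^sup>2" using pq by (simp add: y_def algebra_simps power2_eq_square)
  finally have "3 \<le> (2 - y)\<^sup>2" by (simp add: power2_eq_square algebra_simps)
  then have "sqrt 3 \<le> 2 - y" using y1 by (intro real_le_lsqrt) auto
  then have "y \<le> 2 - sqrt 3" by simp
  then have "q\<^sup>2 \<le> (2 - sqrt 3)\<^sup>2" using y0 power_mono[of y "2 - sqrt 3" 2] by (simp add: y_def)
  also have "\<dots> = rho"
  proof -
    have "(2 - sqrt 3) * (2 + sqrt 3) = 1" by (simp add: algebra_simps)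
    moreover have "2 + sqrt 3 > 0" by (simp add: add_pos_nonneg)
    ultimately have "2 - sqrt 3 = 1 / (2 + sqrt 3)" by (simp only: eq_divide_eq) simp
    then show ?thesis by (metis divide_inverse inverse_eq_divide power2_eq_square rho_def)
  qed
  finally show "q\<^sup>2 \<le> rho" .
qed

lemma rho_bounds: "0 < rho" "rho \<le> 1 / 9"
proof -
  have "sqrt 3 < 2" by (rule real_less_lsqrt) auto
  moreover have "8 / 5 \<le> sqrt 3" by (rule real_le_rsqrt) (simp add: power2_eq_square)
  ultimately show "0 < rho" "rho \<le> 1 / 9" by (simp_all add: rho_def field_simps)
qed

context root_pair
begin

lemma quadratic: "u * s * p\<^sup>2 + (1 - u ^ 4 - 4 * w * u\<^sup>2) * p + u * s = 0"
proof -
  have "u * s * p\<^sup>2 + u * s * (p * q) = (u * s * (p + q)) * p"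
    by (simp add: power2_eq_square algebra_simps)
  then show ?thesis unfolding prod char[folded s_def] by (simp add: algebra_simps)
qed

text \<open>
  The denominator \<open>tcoef_a \<alpha> + u\<^sup>2 tcoef_b\<close> of the theorem is \<open>u\<close> times this number. Cleared of denominators,
  the two sides differ by the multiple \<open>1 - u (1 + w) p\<close> of the quadratic equation of \<open>p\<close>.
\<close>
lemma den_eq:
  "(1 - u\<^sup>2 - 2 * u\<^sup>2 * w - u\<^sup>2 * w\<^sup>2) * p + u * s
    = w\<^sup>2 * u\<^sup>2 * p ^ 3 * (1 - u * q)\<^sup>2 / (1 - u * p)\<^sup>2"
proof -
  interpret sw: root_pair w u q p by (rule swap)
  have "p - u * (p * q) = p * (1 - u * q)" by (simp add: algebra_simps)
  then have pc: "(p - u)\<^sup>2 = p\<^sup>2 * (1 - u * q)\<^sup>2" by (simp add: prod power_mult_distrib)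
  have "(1 - u * p)\<^sup>2 * ((1 - u\<^sup>2 - 2 * u\<^sup>2 * w - u\<^sup>2 * w\<^sup>2) * p + u * s) - w\<^sup>2 * u\<^sup>2 * p * (p - u)\<^sup>2
    = (1 - u * (1 + w) * p) * (u * s * p\<^sup>2 + (1 - u ^ 4 - 4 * w * u\<^sup>2) * p + u * s)"
    unfolding s_def by (simp add: algebra_simps eval_nat_numeral)
  then have "((1 - u\<^sup>2 - 2 * u\<^sup>2 * w - u\<^sup>2 * w\<^sup>2) * p + u * s) * (1 - u * p)\<^sup>2
    = w\<^sup>2 * u\<^sup>2 * p ^ 3 * (1 - u * q)\<^sup>2"
    unfolding quadratic pc by (simp add: power2_eq_square power3_eq_cube mult_ac)
  then show ?thesis using sw.one_minus_uq_gt_1 by (subst eq_divide_eq) simp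
qed

end

text \<open>
  Reduces an identity between a polynomial and an expression with poles at \<open>d = 0\<close> to a polynomial one.
\<close>
lemma laurent_cancel:
  fixes d :: real
  assumes "d \<noteq> 0" "(t - h) * d\<^sup>2 - x * d - y = 0"
  shows "h + x / d + y / d\<^sup>2 = t"
proof -
  have "h + x / d + y / d\<^sup>2 - t = - ((t - h) * d\<^sup>2 - x * d - y) / d\<^sup>2"
    using assms(1) by (simp add: field_simps power2_eq_square)
  then show ?thesis using assms(2) by simp
qed

text \<open>
  On the zero set of the quadratic polynomial of \<open>p\<close>, the poles of \<open>C3\<close> and \<open>C7\<close> at \<open>p = u\<close> cancel. The constant
  \<open>C6\<close> is the combination of these two by \<open>ttau_m1\<close> and \<open>- ttau_m2\<close>, in which the terms with \<open>tau_0\<close>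
  drop out.
\<close>
lemma
  fixes w p q :: real
  assumes "root_pair w (uw w) p q"
  defines "u \<equiv> uw w" and "s \<equiv> tcoef_b w"
  shows C3_eq: "C3 w (u * p) = u * s * (1 - 2 * u * p)"
    and C7_eq: "C7 w (u * p) = tau_0 w * (1 - 2 * u * p) - 2 * u\<^sup>2 * s * p\<^sup>2"
    and C6_eq: "C6 w (u * p) = (u * s * (1 - u * p))\<^sup>2"
proof -
  interpret rp: root_pair w "uw w" p q by fact
  have s: "s = u\<^sup>2 + w + u\<^sup>2 * w - 1" by (simp add: s_def u_def tcoef_b_def)
  have chi: "u * s * p\<^sup>2 + (1 - u ^ 4 - 4 * w * u\<^sup>2) * p + u * s = 0"
    using rp.quadratic by (simp add: s u_def rp.s_def)
  have s0: "s > 0" unfolding s_def by (rule tcoef_b_pos[OF rp.w_pos])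
  have u0: "u > 0" using rp.u_pos by (simp add: u_def)
  have d0: "p - u \<noteq> 0" using rp.p_neg u0 by simp
  have X: "X_of w (u * p) = u * s * (p - u)"
    unfolding X_of_def leading_coef_eq unfolding tau_m1_eq u_def[symmetric] s_def[symmetric] by (simp add: algebra_simps)
  have t2: "htau_m2 w = 2 * u\<^sup>2 * s" "tau_m1 w = u * s"
    by (simp_all add: htau_m2_def tau_m1_eq power2_eq_square flip: u_def s_def)
  let ?Q1 = "w * (1 - 4 * u\<^sup>2 + 3 * u ^ 4) + (1 - u\<^sup>2)\<^sup>2"
  let ?Q2 = "w * (2 - 6 * u\<^sup>2 + 4 * u ^ 4) + (1 - u\<^sup>2)\<^sup>2"
  have C3': "C3 w (u * p) = htau_m1 w + 2 * u\<^sup>2 * ?Q1 / (p - u) + 2 * w * u ^ 3 * (1 - u\<^sup>2)\<^sup>2 / (p - u)\<^sup>2"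
    unfolding C3_def X t2 u_def[symmetric] using s0 u0 by (simp add: power2_eq_square power3_eq_cube mult_ac)
  have C7': "C7 w (u * p) = htau_0 w + 2 * u ^ 3 * ?Q2 / (p - u) + 2 * w * u ^ 4 * (1 - u\<^sup>2)\<^sup>2 / (p - u)\<^sup>2"
    unfolding C7_def X t2 u_def[symmetric] using s0 u0 by (simp add: power2_eq_square power3_eq_cube power4_eq_xxxx mult_ac)
  have C6': "C6 w (u * p) = ttau_m1 w * C3 w (u * p) - ttau_m2 w * C7 w (u * p)"
    unfolding C6_def C3_def C7_def u_def[symmetric] by (simp add: divide_inverse algebra_simps eval_nat_numeral)
  \<comment> \<open>The cofactor \<open>- 2 u p\<close> comes from comparing the leading coefficients in \<open>p\<close>;
    the division leaves no remainder.\<close>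
  have "(u * s * (1 - 2 * u * p) - htau_m1 w) * (p - u)\<^sup>2 - 2 * u\<^sup>2 * ?Q1 * (p - u) - 2 * w * u ^ 3 * (1 - u\<^sup>2)\<^sup>2
    = - 2 * u * p * (u * s * p\<^sup>2 + (1 - u ^ 4 - 4 * w * u\<^sup>2) * p + u * s)"
    unfolding s htau_m1_def u_def[symmetric] by (simp add: algebra_simps eval_nat_numeral)
  then show 3: "C3 w (u * p) = u * s * (1 - 2 * u * p)"
    unfolding chi C3' by (intro laurent_cancel[OF d0]) simp
  have "(tau_0 w * (1 - 2 * u * p) - 2 * u\<^sup>2 * s * p\<^sup>2 - htau_0 w) * (p - u)\<^sup>2
      - 2 * u ^ 3 * ?Q2 * (p - u) - 2 * w * u ^ 4 * (1 - u\<^sup>2)\<^sup>2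
    = - 2 * u * p\<^sup>2 * (u * s * p\<^sup>2 + (1 - u ^ 4 - 4 * w * u\<^sup>2) * p + u * s)"
    unfolding s tau_0_def htau_0_def u_def[symmetric] by (simp add: algebra_simps eval_nat_numeral)
  then show 7: "C7 w (u * p) = tau_0 w * (1 - 2 * u * p) - 2 * u\<^sup>2 * s * p\<^sup>2"
    unfolding chi C7' by (intro laurent_cancel[OF d0]) simp
  have tt: "ttau_m1 w = u * s + u * tau_0 w / 2" "ttau_m2 w = u\<^sup>2 * s / 2"
    by (simp_all add: ttau_m1_def ttau_m2_def tau_0_def t2 flip: u_def)
       (simp_all add: s field_simps eval_nat_numeral)
  show "C6 w (u * p) = (u * s * (1 - u * p))\<^sup>2"
    unfolding C6' 3 7 tt by (simp add: field_simps eval_nat_numeral)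
qed

section \<open>Linear algebra of the covariance matrix\<close>

lemma R_mat_entry:
  assumes "1 \<le> k" "k \<le> n" "1 \<le> l" "l \<le> n"
  shows "R_mat \<theta> n $$ (k - 1, l - 1) = kern (\<theta> / real n) (uw (\<theta> / real n)) k l"
  using assms by (auto simp: R_mat_def kern_def uw_def Let_def of_nat_diff)

lemma R_mat_carrier: "R_mat \<theta> n \<in> carrier_mat n n"
  by (simp add: R_mat_def)

lemma R_mat_mult_vec:
  assumes "1 \<le> k" "k \<le> n"
  shows "(R_mat \<theta> n *\<^sub>v vec n (\<lambda>i. x (i + 1))) $ (k - 1)
    = kern_sum (\<theta> / real n) (uw (\<theta> / real n)) n x k"
proof -
  have "(R_mat \<theta> n *\<^sub>v vec n (\<lambda>i. x (i + 1))) $ (k - 1)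
    = (\<Sum>l<n. R_mat \<theta> n $$ (k - 1, l) * x (l + 1))"
    using assms R_mat_carrier[of \<theta> n]
    by (auto simp: scalar_prod_def lessThan_atLeast0 intro!: sum.cong)
  also have "\<dots> = kern_sum (\<theta> / real n) (uw (\<theta> / real n)) n x k"
    unfolding kern_sum_def
    by (rule sum.reindex_bij_witness[of _ "\<lambda>l. l - 1" "\<lambda>l. l + 1"])
       (use assms in \<open>auto simp flip: R_mat_entry\<close>)
  finally show ?thesis .
qed

lemma R_mat_inverse_exists:
  assumes inj: "\<And>x k. (\<And>k. 1 \<le> k \<Longrightarrow> k \<le> n \<Longrightarrow> kern_sum (\<theta> / real n) (uw (\<theta> / real n)) n x k = 0)
      \<Longrightarrow> 1 \<le> k \<Longrightarrow> k \<le> n \<Longrightarrow> x k = 0"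
  obtains B where "mat_inverse (R_mat \<theta> n) = Some B"
proof -
  have "det (R_mat \<theta> n) \<noteq> 0"
  proof
    assume "det (R_mat \<theta> n) = 0"
    then obtain v where v: "v \<in> carrier_vec n" "v \<noteq> 0\<^sub>v n" "R_mat \<theta> n *\<^sub>v v = 0\<^sub>v n"
      using det_0_iff_vec_prod_zero[OF R_mat_carrier] by blast
    define x where "x k = v $ (k - 1)" for k
    have vx: "v = vec n (\<lambda>i. x (i + 1))" using v(1) by (auto simp: x_def)
    have "x k = 0" if "1 \<le> k" "k \<le> n" for k
    proof (rule inj[OF _ that])
      fix k assume k: "1 \<le> k" "k \<le> n"
      show "kern_sum (\<theta> / real n) (uw (\<theta> / real n)) n x k = 0"
        using R_mat_mult_vec[OF k, of \<theta> x] v(3) k unfolding vx[symmetric] by simp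
    qed
    then have "v = 0\<^sub>v n" unfolding vx by auto
    with v(2) show False ..
  qed
  then have "R_mat \<theta> n \<in> Units (ring_mat TYPE(real) n ())"
    by (rule det_non_zero_imp_unit[OF R_mat_carrier])
  then show ?thesis
    using mat_inverse(1)[OF R_mat_carrier, where b = "()"] that by (cases "mat_inverse (R_mat \<theta> n)") auto
qed

lemma R_mat_invertible:
  assumes "mat_inverse (R_mat \<theta> n) = Some B"
  shows "invertible_mat (R_mat \<theta> n)"
  using mat_inverse(2)[OF R_mat_carrier assms] R_mat_carrier[of \<theta> n]
  by (auto simp: invertible_mat_def inverts_mat_def)

text \<open>
  The inverse undoes the convolution. Applied to a sequence \<open>x\<close> with a sparse image, this expresses
  \<open>x i\<close> by the few entries of row \<open>i\<close> of the inverse that the image selects.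
\<close>
lemma R_inv_kern_sum:
  assumes B: "mat_inverse (R_mat \<theta> n) = Some B" and i: "1 \<le> i" "i \<le> n"
  shows "(\<Sum>k = 1..n. R_inv \<theta> n i k * kern_sum (\<theta> / real n) (uw (\<theta> / real n)) n x k) = x i"
proof -
  have BR: "B * R_mat \<theta> n = 1\<^sub>m n" and Bc: "B \<in> carrier_mat n n"
    using mat_inverse(2)[OF R_mat_carrier B] by auto
  let ?v = "vec n (\<lambda>i. x (i + 1))"
  have "B *\<^sub>v (R_mat \<theta> n *\<^sub>v ?v) = ?v"
    using assoc_mult_mat_vec[OF Bc R_mat_carrier, of ?v \<theta>] by (simp add: BR)
  then have "x i = (B *\<^sub>v (R_mat \<theta> n *\<^sub>v ?v)) $ (i - 1)" using i by (cases i) simp_all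
  also have "\<dots> = (\<Sum>k<n. B $$ (i - 1, k) * (R_mat \<theta> n *\<^sub>v ?v) $ k)"
    using i Bc R_mat_carrier[of \<theta> n] by (auto simp: scalar_prod_def lessThan_atLeast0 intro!: sum.cong)
  also have "\<dots> = (\<Sum>k = 1..n. R_inv \<theta> n i k * kern_sum (\<theta> / real n) (uw (\<theta> / real n)) n x k)"
    by (rule sum.reindex_bij_witness[of _ "\<lambda>k. k - 1" "\<lambda>k. k + 1"])
       (auto simp: R_inv_def B simp flip: R_mat_mult_vec)
  finally show ?thesis ..
qed

lemma kern_sum_symmetric:
  "(\<Sum>k = 1..n. y k * kern_sum w u n x k) = (\<Sum>k = 1..n. x k * kern_sum w u n y k)"
  unfolding kern_sum_def sum_distrib_left
  by (subst sum.swap) (simp add: kern_commute mult_ac cong: sum.cong)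

text \<open>
  These weights annihilate \<open>u\<^sup>l\<close> and \<open>l u\<^sup>l\<close>, hence the kernel as seen from any row to the left.
\<close>
definition stencil :: "real \<Rightarrow> nat \<Rightarrow> nat \<Rightarrow> real" where
  "stencil u j l = (if l = j then u\<^sup>2 else if l = j + 1 then - 2 * u else if l = j + 2 then 1 else 0)"

lemma kern_sum_stencil:
  assumes "1 \<le> j" "j + 2 \<le> n"
  shows "1 \<le> k \<Longrightarrow> k \<le> j \<Longrightarrow> kern_sum w u n (stencil u j) k = 0"
    and "kern_sum w u n (stencil u j) (j + 1) = u * (u\<^sup>2 + w + u\<^sup>2 * w - 1)"
    and "kern_sum w u n (stencil u j) (j + 2) = 1 - 2 * (1 + w) * u\<^sup>2 + (1 + 2 * w) * u ^ 4"
proof -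
  have *: "kern_sum w u n (stencil u j) k
    = kern w u k j * u\<^sup>2 + kern w u k (j + 1) * (- 2 * u) + kern w u k (j + 2)" for k
    using kern_sum_three[OF assms, of "stencil u j" w u k] by (simp add: stencil_def)
  show "kern_sum w u n (stencil u j) k = 0" if "1 \<le> k" "k \<le> j"
  proof -
    obtain d where j: "j = k + d" using \<open>k \<le> j\<close> le_Suc_ex by blast
    show ?thesis unfolding * unfolding j by (simp add: kern_below) (simp add: algebra_simps power2_eq_square)
  qed
  show "kern_sum w u n (stencil u j) (j + 1) = u * (u\<^sup>2 + w + u\<^sup>2 * w - 1)"
    unfolding * by (simp add: kern_above kern_below algebra_simps power2_eq_square)
  show "kern_sum w u n (stencil u j) (j + 2) = 1 - 2 * (1 + w) * u\<^sup>2 + (1 + 2 * w) * u ^ 4"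
    unfolding * by (simp add: kern_above kern_below algebra_simps eval_nat_numeral)
qed

section \<open>Solving for the end columns\<close>

context root_pair
begin

definition ratio :: real where "ratio = (1 - u * p) / (1 - u * q)"

text \<open>
  The determinant of the \<open>2 \<times> 2\<close> system for the two end columns is \<open>1 - defect n\<close> up to a factor.
\<close>
definition defect :: "nat \<Rightarrow> real" where
  "defect n = q ^ (2 * n + 2) * ratio ^ 4"

text \<open>
  The last column of the inverse matrix, multiplied by \<open>1 - defect n\<close>.
\<close>
definition column :: "nat \<Rightarrow> nat \<Rightarrow> real" where
  "column n i = q ^ (n + 1) * (1 - u * p)\<^sup>2 / (u * s)
     * (root_pair.mode u q p n i * ratio\<^sup>2 - mode n i)"

lemma one_minus_up_gt_1: "1 - u * p > 1"
  using u_pos p_neg by (simp add: mult_pos_neg)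

lemma power_inverse: "p ^ k * q ^ k = 1" "q ^ k * p ^ k = 1"
  by (simp_all add: prod mult.commute flip: power_mult_distrib)

text \<open>
  Reversal of the order turns the mode of \<open>p\<close> into a multiple of the mode of \<open>q\<close>. Therefore the first
  column is the reversed last column.
\<close>
lemma mode_reflect:
  assumes "1 \<le> k" "k \<le> n"
  shows "mode n (n + 1 - k) = p ^ (n + 1) * root_pair.mode u q p n k"
proof -
  interpret sw: root_pair w u q p by (rule swap)
  have "p ^ (n + 1 - k) * (p ^ k * q ^ k) = p ^ (n + 1) * q ^ k"
    using assms by (simp only: mult.assoc[symmetric] power_add[symmetric]) simp
  then have pk: "p ^ (n + 1 - k) = p ^ (n + 1) * q ^ k" by (simp add: power_inverse)
  have "p ^ (n + 1) * sw.mode n k = p ^ (n + 1) * q ^ k + p ^ (n + 1) * sw.edge k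
      + p ^ (n + 1) * q ^ (n + 1) * edge (n + 1 - k)"
    unfolding sw.mode_def by (simp only: algebra_simps)
  also have "\<dots> = mode n (n + 1 - k)"
    unfolding mode_def pk power_inverse using assms by simp
  finally show ?thesis ..
qed

lemma
  assumes "5 \<le> n"
  shows mode_1: "mode n 1 = p / (1 - u * q)\<^sup>2"
    and mode_2: "mode n 2 = p\<^sup>2 * (1 - 2 * u * q) / (1 - u * q)\<^sup>2"
    and mode_interior: "3 \<le> i \<Longrightarrow> i \<le> n - 2 \<Longrightarrow> mode n i = p ^ i"
proof -
  interpret sw: root_pair w u q p by (rule swap)
  have "p * (1 - u * q)\<^sup>2 + u * (2 - u * q) = p + u * 2 * (1 - p * q) - u\<^sup>2 * q * (1 - p * q)"
    by (simp add: power2_eq_square algebra_simps)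
  moreover have "sw.edge (n + 1 - 1) = 0" using assms by (auto simp: sw.edge_def)
  ultimately show "mode n 1 = p / (1 - u * q)\<^sup>2"
    unfolding mode_def using one_minus_uq_gt_1 prod by (simp add: edge_def field_simps)
  have "p\<^sup>2 * (1 - u * q)\<^sup>2 - u\<^sup>2 = p\<^sup>2 * (1 - 2 * u * q) + u\<^sup>2 * ((p * q)\<^sup>2 - 1)"
    by (simp add: power2_eq_square algebra_simps)
  moreover have "sw.edge (n + 1 - 2) = 0" using assms by (auto simp: sw.edge_def)
  ultimately show "mode n 2 = p\<^sup>2 * (1 - 2 * u * q) / (1 - u * q)\<^sup>2"
    unfolding mode_def using one_minus_uq_gt_1 prod by (simp add: edge_def field_simps)
  show "mode n i = p ^ i" if "3 \<le> i" "i \<le> n - 2"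
    unfolding mode_def edge_def sw.edge_def using assms that by auto
qed

lemma leak_ratio: "leak = ratio\<^sup>2 * root_pair.leak w u p"
proof -
  interpret sw: root_pair w u q p by (rule swap)
  show ?thesis using one_minus_up_gt_1 by (simp add: leak_def sw.leak_def ratio_def power_divide)
qed

text \<open>
  Elimination of \<open>x\<close>. For \<open>x\<close> and \<open>y\<close> the entries \<open>(i,1)\<close> and \<open>(i,n)\<close> of the inverse, the hypotheses hold with
  \<open>v\<close> and \<open>v'\<close> the values of the two modes at \<open>i\<close>.
\<close>
lemma solve_boundary_system:
  assumes s: "s \<noteq> 0"
    and e1: "v = leak * x + p ^ (n + 1) * root_pair.leak w u p * y"
    and e2: "v' = root_pair.leak w u p * x + q ^ (n + 1) * leak * y"
  shows "y * (1 - defect n) = q ^ (n + 1) * (1 - u * p)\<^sup>2 / (u * s) * (v' * ratio\<^sup>2 - v)"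
proof -
  interpret sw: root_pair w u q p by (rule swap)
  have "v' * ratio\<^sup>2 - v = (- sw.leak) * (y * (p ^ (n + 1) - q ^ (n + 1) * ratio ^ 4))"
    unfolding e1 e2 leak_ratio by (simp add: algebra_simps power2_eq_square power4_eq_xxxx)
  then have "q ^ (n + 1) * (1 - u * p)\<^sup>2 / (u * s) * (v' * ratio\<^sup>2 - v)
    = q ^ (n + 1) * ((1 - u * p)\<^sup>2 / (u * s) * (- sw.leak)) * y * (p ^ (n + 1) - q ^ (n + 1) * ratio ^ 4)"
    by (simp add: mult_ac)
  also have "(1 - u * p)\<^sup>2 / (u * s) * (- sw.leak) = 1"
    using one_minus_up_gt_1 s u_pos by (simp add: sw.leak_def)
  also have "q ^ (n + 1) * 1 * y * (p ^ (n + 1) - q ^ (n + 1) * ratio ^ 4)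
    = y * (q ^ (n + 1) * p ^ (n + 1) - q ^ ((n + 1) + (n + 1)) * ratio ^ 4)"
    by (simp only: power_add) (simp only: algebra_simps)
  also have "\<dots> = y * (1 - defect n)"
    unfolding power_inverse defect_def by (simp add: mult_2)
  finally show ?thesis ..
qed

lemma
  assumes n: "5 \<le> n" and s: "s \<noteq> 0"
  shows column_1: "column n 1 = - (q ^ (n + 1) * ratio\<^sup>2 * (p - q) / (u * s))"
    and column_2: "column n 2 = - (q ^ (n + 1) * ratio\<^sup>2 * (p - q) * (p + q - 2 * u) / (u * s))"
    and column_interior: "3 \<le> i \<Longrightarrow> i \<le> n - 2 \<Longrightarrow>
      column n i = q ^ (n + 1) * (1 - u * p)\<^sup>2 / (u * s) * (q ^ i * ratio\<^sup>2 - p ^ i)"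
    and column_n: "column n n = - (q / (u * s)) * (1 - q ^ (2 * n) * ratio ^ 4)"
    and column_pred: "column n (n - 1) = - (q\<^sup>2 / (u * s))
      * ((1 - 2 * u * p) - q ^ (2 * n - 2) * ratio ^ 4 * (1 - 2 * u * q))"
proof -
  interpret sw: root_pair w u q p by (rule swap)
  have us: "u * s \<noteq> 0" using u_pos s by simp
  have a: "1 - u * p \<noteq> 0" and c: "1 - u * q \<noteq> 0" using one_minus_up_gt_1 one_minus_uq_gt_1 by auto
  have red: "column n i = q ^ (n + 1) * ratio\<^sup>2 / (u * s) * (P' - P)"
    if "mode n i = P / (1 - u * q)\<^sup>2" "sw.mode n i = P' / (1 - u * p)\<^sup>2" for i P P'
    unfolding column_def that using a c us
    by (simp add: ratio_def power_divide) (simp add: divide_simps; simp add: algebra_simps)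
  show "column n 1 = - (q ^ (n + 1) * ratio\<^sup>2 * (p - q) / (u * s))"
    unfolding red[OF mode_1[OF n] sw.mode_1[OF n]] by (simp add: algebra_simps diff_divide_distrib)
  have "q\<^sup>2 * (1 - 2 * u * p) - p\<^sup>2 * (1 - 2 * u * q)
    = - ((p - q) * (p + q - 2 * u * (p * q)))"
    by (simp add: algebra_simps power2_eq_square)
  then show "column n 2 = - (q ^ (n + 1) * ratio\<^sup>2 * (p - q) * (p + q - 2 * u) / (u * s))"
    unfolding red[OF mode_2[OF n] sw.mode_2[OF n]] prod by simp
  show "column n i = q ^ (n + 1) * (1 - u * p)\<^sup>2 / (u * s) * (q ^ i * ratio\<^sup>2 - p ^ i)"
    if "3 \<le> i" "i \<le> n - 2"
    unfolding column_def using mode_interior[OF n that] sw.mode_interior[OF n that] by simp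
  have cancel: "A / S * (Q * (P / C) * R - 1 * (P' / A)) = (Q * (A / C * R) * P - P') / S"
    if "A \<noteq> 0" for A S Q P C R P' :: real
    using that by (simp add: algebra_simps diff_divide_distrib)
  \<comment> \<open>The positions \<open>n\<close> and \<open>n - 1\<close> are the reflections of \<open>1\<close> and \<open>2\<close>.\<close>
  have far: "column n (n + 1 - k) = (q ^ (2 * n + 2) * ratio ^ 4 * P - P') / (u * s)"
    if k: "1 \<le> k" "k \<le> n" and "mode n k = P / (1 - u * q)\<^sup>2" "sw.mode n k = P' / (1 - u * p)\<^sup>2"
    for k P P'
  proof -
    have "column n (n + 1 - k) = (1 - u * p)\<^sup>2 / (u * s)
      * (q ^ ((n + 1) + (n + 1)) * (P / (1 - u * q)\<^sup>2) * ratio\<^sup>2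
        - q ^ (n + 1) * p ^ (n + 1) * (P' / (1 - u * p)\<^sup>2))"
      unfolding column_def mode_reflect[OF k] sw.mode_reflect[OF k] that(3,4) power_add
      by (simp add: divide_inverse algebra_simps)
    also have "\<dots> = (q ^ (2 * n + 2) * (((1 - u * p)\<^sup>2 / (1 - u * q)\<^sup>2) * ratio\<^sup>2) * P - P') / (u * s)"
      unfolding power_inverse using a by (subst cancel) (simp_all add: mult_2 add_ac)
    also have "(1 - u * p)\<^sup>2 / (1 - u * q)\<^sup>2 * ratio\<^sup>2 = ratio ^ 4"
      by (simp add: ratio_def power_divide flip: power_add)
    finally show ?thesis .
  qed
  have "q ^ (2 * n + 2) * p = q ^ (2 * n) * q * (q * p)" by (simp add: power2_eq_square)
  then have q1: "q ^ (2 * n + 2) * ratio ^ 4 * p = q * (q ^ (2 * n) * ratio ^ 4)" by (simp add: prod mult.commute)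
  have "column n (n + 1 - 1) = - (q / (u * s)) * (1 - q ^ (2 * n) * ratio ^ 4)"
    unfolding far[of 1, OF _ _ mode_1[OF n] sw.mode_1[OF n], simplified] using n q1
    by (subst far[of 1, OF _ _ mode_1[OF n] sw.mode_1[OF n]]) (auto simp: algebra_simps diff_divide_distrib)
  then show "column n n = - (q / (u * s)) * (1 - q ^ (2 * n) * ratio ^ 4)" by simp
  have n2: "2 * n + 2 = (2 * n - 2) + 2 + 2" using n by simp
  have "q ^ (2 * n + 2) * p\<^sup>2 = q ^ (2 * n - 2) * q\<^sup>2 * (q\<^sup>2 * p\<^sup>2)"
    unfolding n2 power_add by (simp only: mult.assoc)
  then have q2: "q ^ (2 * n + 2) * p\<^sup>2 = q\<^sup>2 * q ^ (2 * n - 2)" by (simp add: power_inverse)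
  have "column n (n + 1 - 2) = (q ^ (2 * n + 2) * p\<^sup>2 * (ratio ^ 4 * (1 - 2 * u * q)) - q\<^sup>2 * (1 - 2 * u * p)) / (u * s)"
    using n by (subst far[of 2, OF _ _ mode_2[OF n] sw.mode_2[OF n]]) (auto simp: mult_ac)
  also have "\<dots> = - (q\<^sup>2 / (u * s))
      * ((1 - 2 * u * p) - q ^ (2 * n - 2) * ratio ^ 4 * (1 - 2 * u * q))"
  proof -
    have "Q * Z * (R * B) - Q * A = - Q * (A - Z * R * B)" for Q Z R A B :: real
      by (simp add: algebra_simps)
    then show ?thesis unfolding q2 by simp
  qed
  finally show "column n (n - 1) = - (q\<^sup>2 / (u * s))
      * ((1 - 2 * u * p) - q ^ (2 * n - 2) * ratio ^ 4 * (1 - 2 * u * q))" by simp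
qed

text \<open>
  With \<open>q = 1 / p\<close> the upper bound is \<open>(1 - u) (1 + p) \<le> 0\<close>.
\<close>
lemma ratio_bound:
  assumes "u \<le> 1" "p \<le> -1"
  shows "0 < ratio" "ratio \<le> - p"
proof -
  show "0 < ratio" using one_minus_up_gt_1 one_minus_uq_gt_1 by (simp add: ratio_def)
  have "(1 - u) * (1 + p) \<le> 0" using assms by (intro mult_nonneg_nonpos) auto
  moreover have "- p * (1 - u * q) = - p + u" using prod by (simp add: algebra_simps)
  ultimately have "1 - u * p \<le> - p * (1 - u * q)" by (simp only: algebra_simps)
  then show "ratio \<le> - p" using one_minus_uq_gt_1 by (simp add: ratio_def pos_divide_le_eq)
qed

text \<open>
  As \<open>ratio \<le> 1 / \<bar>q\<bar>\<close>, the factor \<open>ratio\<^sup>4\<close> uses up four of the powers of \<open>q\<close>.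
\<close>
lemma q_power_ratio_bound:
  assumes "u \<le> 1" "p \<le> -1" "q\<^sup>2 \<le> \<rho>"
  shows "q ^ (2 * m + 4) * ratio ^ 4 \<le> \<rho> ^ m"
proof -
  have "ratio ^ 4 \<le> (- p) ^ 4" using ratio_bound[OF assms(1,2)] by (intro power_mono) auto
  then have "q ^ (2 * m + 4) * ratio ^ 4 \<le> q ^ (2 * m + 4) * (- p) ^ 4"
    by (intro mult_left_mono) (simp_all add: zero_le_even_power)
  also have "\<dots> = q ^ (2 * m) * (q ^ 4 * p ^ 4)" by (simp add: power_add)
  also have "\<dots> = (q\<^sup>2) ^ m" by (simp add: power_inverse power_mult)
  also have "\<dots> \<le> \<rho> ^ m" using assms(3) by (intro power_mono) auto
  finally show ?thesis .
qed

text \<open>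
  By symmetry of the kernel, \<open>x\<close> is orthogonal to the image of every sequence. The two modes then
  give \<open>x 1 = x n = 0\<close>, and the stencil placed at \<open>j\<close>, whose image vanishes up to \<open>j\<close>, gives
  \<open>x (j + 1) = 0\<close> once all later values are known to vanish.
\<close>
lemma kern_sum_eq_0_imp:
  assumes n: "3 \<le> n" and s: "s \<noteq> 0" and def: "defect n \<noteq> 1"
    and zero: "\<And>k. 1 \<le> k \<Longrightarrow> k \<le> n \<Longrightarrow> kern_sum w u n x k = 0"
    and k: "1 \<le> k" "k \<le> n"
  shows "x k = 0"
proof -
  interpret sw: root_pair w u q p by (rule swap)
  have orth: "(\<Sum>k = 1..n. x k * kern_sum w u n y k) = 0" for y
    unfolding kern_sum_symmetric[of x] using zero by simp
  have ends: "(\<Sum>k = 1..n. x k * ((if k = 1 then c else 0) + (if k = n then d else 0))) = c * x 1 + d * x n" for c d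
    using n by (simp add: distrib_left sum.distrib if_distrib[of "\<lambda>z. _ * z"] sum.delta cong: if_cong)
  have "(\<Sum>k = 1..n. x k * ((if k = 1 then leak else 0) + (if k = n then p ^ (n + 1) * sw.leak else 0))) = 0"
    by (rule trans[OF _ orth[of "mode n"]], rule sum.cong[OF refl]) (use n in \<open>simp add: kern_sum_mode\<close>)
  then have e1: "0 = leak * x 1 + p ^ (n + 1) * sw.leak * x n" unfolding ends by simp
  have "(\<Sum>k = 1..n. x k * ((if k = 1 then sw.leak else 0) + (if k = n then q ^ (n + 1) * leak else 0))) = 0"
    by (rule trans[OF _ orth[of "sw.mode n"]], rule sum.cong[OF refl]) (use n in \<open>simp add: sw.kern_sum_mode\<close>)
  then have e2: "0 = sw.leak * x 1 + q ^ (n + 1) * leak * x n" unfolding ends by simp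
  have xn: "x n = 0" using solve_boundary_system[OF s e1 e2] def by simp
  have "sw.leak \<noteq> 0" using u_pos s one_minus_up_gt_1 by (simp add: sw.leak_def)
  with e2 xn have x1: "x 1 = 0" by simp
  show ?thesis using k
  proof (induction "n - k" arbitrary: k rule: less_induct)
    case less
    show ?case
    proof (cases "k = 1 \<or> k = n")
      case True
      then show ?thesis using x1 xn by auto
    next
      case False
      define j where "j = k - 1"
      have j: "1 \<le> j" "j + 2 \<le> n" "k = j + 1" using False less.prems by (auto simp: j_def)
      have "(\<Sum>l\<in>{1..n} - {k}. x l * kern_sum w u n (stencil u j) l) = 0"
      proof (rule sum.neutral, rule ballI)
        fix l assume l: "l \<in> {1..n} - {k}"
        show "x l * kern_sum w u n (stencil u j) l = 0"
        proof (cases "l \<le> j")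
          case True
          then show ?thesis using kern_sum_stencil(1)[OF j(1,2)] l by simp
        next
          case False
          then have "x l = 0" using l j less.prems by (intro less.hyps) auto
          then show ?thesis by simp
        qed
      qed
      then have "x k * kern_sum w u n (stencil u j) (j + 1) = 0"
        using orth[of "stencil u j"] less.prems sum.remove[of "{1..n}" k "\<lambda>l. x l * kern_sum w u n (stencil u j) l"]
        unfolding j(3)[symmetric] by simp
      then show ?thesis using s u_pos unfolding kern_sum_stencil(2)[OF j(1,2)] s_def by simp
    qed
  qed
qed

end

section \<open>Columns of the inverse covariance matrix\<close>

text \<open>
  The situation of the theorem for fixed \<open>\<theta>\<close> and \<open>n\<close>. For \<open>n \<ge> 5\<close> the positions \<open>1, 2, n - 1, n\<close> are
  distinct and the interior \<open>3, \<dots>, n - 2\<close> is not empty.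
\<close>
locale scaled_roots =
  fixes \<theta> :: real and n :: nat and w u p q :: real
  assumes \<theta>_pos: "0 < \<theta>" and n_ge: "5 \<le> n"
    and w_eq: "w = \<theta> / real n" and u_eq: "u = uw w"
    and p_eq: "p = alpha1 w / u" and q_eq: "q = alpha2 w / u"
begin

lemma pos: "0 < w" "0 < u"
  using \<theta>_pos n_ge by (simp_all add: w_eq u_eq uw_def)

sublocale root_pair w u p q
  using alpha_root_pair(1)[OF pos(1)] by (simp add: u_eq p_eq q_eq)

sublocale sw: root_pair w u q p
  by (rule swap)

lemma s_eq: "s = tcoef_b w"
  unfolding s_def tcoef_b_def unfolding u_eq ..

lemma s_pos: "0 < s"
  unfolding s_eq by (rule tcoef_b_pos[OF pos(1)])

lemma u_le_1: "u \<le> 1"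
  using pos(1) by (simp add: u_eq uw_def)

lemma p_le: "p \<le> -1"
proof -
  have "p \<le> q" using alpha_root_pair(2)[OF pos(1)] by (simp add: u_eq p_eq q_eq)
  then have "p * p \<ge> p * q" using p_neg by (intro mult_left_mono_neg) auto
  then have "1\<^sup>2 \<le> (- p)\<^sup>2" by (simp add: prod power2_eq_square)
  then show ?thesis using p_neg power2_le_imp_le[of 1 "- p"] by simp
qed

lemma q2_le: "q\<^sup>2 \<le> rho"
  using alpha_root_pair(3)[OF pos(1)] by (simp add: u_eq q_eq)

lemma tail_le: "2 \<le> m \<Longrightarrow> q ^ (2 * m) * ratio ^ 4 \<le> rho ^ (m - 2)"
  using q_power_ratio_bound[OF u_le_1 p_le q2_le, of "m - 2"] by (simp add: diff_mult_distrib2)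

lemma tail_nonneg: "0 \<le> q ^ (2 * m) * ratio ^ 4"
  by (simp add: zero_le_even_power)

lemma defect_bounds: "0 \<le> defect n" "defect n \<le> rho ^ (n - 1)" "defect n \<le> 1 / 2"
proof -
  show "0 \<le> defect n" using tail_nonneg[of "n + 1"] by (simp add: defect_def)
  show le: "defect n \<le> rho ^ (n - 1)" using tail_le[of "n + 1"] n_ge by (simp add: defect_def)
  have "rho ^ (n - 1) \<le> rho ^ 1" using rho_bounds n_ge by (intro power_decreasing) auto
  with le rho_bounds show "defect n \<le> 1 / 2" by simp
qed

lemma inverse_exists: obtains B where "mat_inverse (R_mat \<theta> n) = Some B"
proof (rule R_mat_inverse_exists)
  fix x k
  assume "\<And>k. 1 \<le> k \<Longrightarrow> k \<le> n \<Longrightarrow> kern_sum (\<theta> / real n) (uw (\<theta> / real n)) n x k = 0"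
    and "1 \<le> k" "k \<le> n"
  then show "x k = 0"
    using n_ge s_pos defect_bounds(3) unfolding w_eq[symmetric] u_eq[symmetric]
    by (intro kern_sum_eq_0_imp[of n x k]) auto
qed (rule that)

lemma inverse_ends:
  assumes i: "1 \<le> i" "i \<le> n"
  shows "mode n i = leak * R_inv \<theta> n i 1 + p ^ (n + 1) * sw.leak * R_inv \<theta> n i n"
    and "sw.mode n i = sw.leak * R_inv \<theta> n i 1 + q ^ (n + 1) * leak * R_inv \<theta> n i n"
proof -
  obtain B where B: "mat_inverse (R_mat \<theta> n) = Some B" by (rule inverse_exists)
  have ends: "(\<Sum>k = 1..n. R_inv \<theta> n i k * ((if k = 1 then c else 0) + (if k = n then d else 0)))
    = c * R_inv \<theta> n i 1 + d * R_inv \<theta> n i n" for c d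
    using n_ge by (simp add: distrib_left sum.distrib if_distrib[of "\<lambda>z. _ * z"] sum.delta cong: if_cong)
  have "mode n i = (\<Sum>k = 1..n. R_inv \<theta> n i k
      * ((if k = 1 then leak else 0) + (if k = n then p ^ (n + 1) * sw.leak else 0)))"
    unfolding R_inv_kern_sum[OF B i, of "mode n", folded w_eq, folded u_eq, symmetric]
    by (rule sum.cong[OF refl]) (use n_ge in \<open>simp add: kern_sum_mode\<close>)
  then show "mode n i = leak * R_inv \<theta> n i 1 + p ^ (n + 1) * sw.leak * R_inv \<theta> n i n"
    unfolding ends .
  have "sw.mode n i = (\<Sum>k = 1..n. R_inv \<theta> n i k
      * ((if k = 1 then sw.leak else 0) + (if k = n then q ^ (n + 1) * leak else 0)))"
    unfolding R_inv_kern_sum[OF B i, of "sw.mode n", folded w_eq, folded u_eq, symmetric]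
    by (rule sum.cong[OF refl]) (use n_ge in \<open>simp add: sw.kern_sum_mode\<close>)
  then show "sw.mode n i = sw.leak * R_inv \<theta> n i 1 + q ^ (n + 1) * leak * R_inv \<theta> n i n"
    unfolding ends .
qed

lemma last_column:
  assumes i: "1 \<le> i" "i \<le> n"
  shows "R_inv \<theta> n i n * (1 - defect n) = column n i"
  using solve_boundary_system[OF _ inverse_ends[OF i]] s_pos by (simp add: column_def)

lemma first_column:
  assumes i: "1 \<le> i" "i \<le> n"
  shows "R_inv \<theta> n i 1 * (1 - defect n) = column n (n + 1 - i)"
proof -
  have "p ^ (n + 1) * sw.mode n i
    = leak * R_inv \<theta> n i n * (p ^ (n + 1) * q ^ (n + 1)) + p ^ (n + 1) * sw.leak * R_inv \<theta> n i 1"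
    unfolding inverse_ends(2)[OF i] by (simp only: algebra_simps)
  then have e1: "mode n (n + 1 - i) = leak * R_inv \<theta> n i n + p ^ (n + 1) * sw.leak * R_inv \<theta> n i 1"
    unfolding power_inverse mode_reflect[OF i] by simp
  have "q ^ (n + 1) * mode n i
    = sw.leak * R_inv \<theta> n i n * (p ^ (n + 1) * q ^ (n + 1)) + q ^ (n + 1) * leak * R_inv \<theta> n i 1"
    unfolding inverse_ends(1)[OF i] by (simp only: algebra_simps)
  then have e2: "sw.mode n (n + 1 - i) = sw.leak * R_inv \<theta> n i n + q ^ (n + 1) * leak * R_inv \<theta> n i 1"
    unfolding power_inverse sw.mode_reflect[OF i] by simp
  show ?thesis
    using solve_boundary_system[OF _ e1 e2] s_pos by (simp add: column_def)
qed

text \<open>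
  The image of the stencil at the last three positions is \<open>\<tau>\<^sub>-\<^sub>1 e\<^bsub>n-1\<^esub> + \<tau>\<^sub>0 e\<^sub>n\<close>.
\<close>
lemma penultimate_column:
  assumes i: "1 \<le> i" "i \<le> n"
  shows "tau_m1 w * R_inv \<theta> n i (n - 1) = stencil u (n - 2) i - tau_0 w * R_inv \<theta> n i n"
proof -
  obtain B where B: "mat_inverse (R_mat \<theta> n) = Some B" by (rule inverse_exists)
  let ?S = "\<lambda>k. kern_sum w u n (stencil u (n - 2)) k"
  have j: "1 \<le> n - 2" "n - 2 + 2 \<le> n" using n_ge by auto
  have n: "n - 2 + 1 = n - 1" "n - 2 + 2 = n" using n_ge by auto
  have "stencil u (n - 2) i = (\<Sum>k = 1..n. R_inv \<theta> n i k * ?S k)"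
    using R_inv_kern_sum[OF B i, of "stencil u (n - 2)"] unfolding w_eq[symmetric] u_eq[symmetric] by simp
  also have "\<dots> = (\<Sum>k\<in>{n - 1, n}. R_inv \<theta> n i k * ?S k)"
    by (rule sum.mono_neutral_right) (use n_ge kern_sum_stencil(1)[OF j] in auto)
  also have "\<dots> = R_inv \<theta> n i (n - 1) * ?S (n - 1) + R_inv \<theta> n i n * ?S n"
    using n_ge by simp
  also have "?S (n - 1) = tau_m1 w"
    using kern_sum_stencil(2)[OF j] unfolding n tau_m1_eq by (simp add: u_eq tcoef_b_def)
  also have "?S n = tau_0 w"
    using kern_sum_stencil(3)[OF j] unfolding n by (simp add: tau_0_def u_eq)
  finally show ?thesis by (simp add: algebra_simps)
qed

end

section \<open>The columns in terms of the original constants\<close>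

context scaled_roots
begin

lemma alpha_eq: "alpha1 w = u * p" "alpha2 w = u * q"
  using pos by (simp_all add: p_eq q_eq)

lemma coef_eq: "tau_m1 w = u * s" "coef_b w + tau_m1 w * u = s"
  by (rule tau_m1_eq[of w, folded u_eq s_eq], rule leading_coef_eq[of w, folded u_eq s_eq])

lemma nonzero: "u \<noteq> 0" "s \<noteq> 0" "q \<noteq> 0" "p \<noteq> 0" "w \<noteq> 0" "ratio \<noteq> 0"
  using pos s_pos q_neg p_neg ratio_bound(1)[OF u_le_1 p_le] by auto

lemma p_inverse: "p = 1 / q"
  using prod nonzero by (simp add: field_simps)

lemma den_alpha:
  "tcoef_a w * alpha1 w + u\<^sup>2 * tcoef_b w = w\<^sup>2 * u ^ 3 / (q ^ 3 * ratio\<^sup>2)"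
  "tcoef_a w * alpha2 w + u\<^sup>2 * tcoef_b w = w\<^sup>2 * u ^ 3 * q ^ 3 * ratio\<^sup>2"
proof -
  have *: "tcoef_a w * (u * z) + u\<^sup>2 * tcoef_b w
    = u * ((1 - u\<^sup>2 - 2 * u\<^sup>2 * w - u\<^sup>2 * w\<^sup>2) * z + u * s)" for z
    by (simp add: tcoef_a_def algebra_simps power2_eq_square flip: s_eq u_eq)
  have "tcoef_a w * alpha1 w + u\<^sup>2 * tcoef_b w = u * (w\<^sup>2 * u\<^sup>2 * p ^ 3 / ratio\<^sup>2)"
    unfolding alpha_eq * den_eq by (simp add: ratio_def power_divide)
  then show "tcoef_a w * alpha1 w + u\<^sup>2 * tcoef_b w = w\<^sup>2 * u ^ 3 / (q ^ 3 * ratio\<^sup>2)"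
    by (subst (asm) p_inverse) (simp add: power_divide power2_eq_square power3_eq_cube mult_ac)
  have "tcoef_a w * alpha2 w + u\<^sup>2 * tcoef_b w = u * (w\<^sup>2 * u\<^sup>2 * q ^ 3 * ratio\<^sup>2)"
    unfolding alpha_eq * sw.den_eq by (simp add: ratio_def power_divide)
  then show "tcoef_a w * alpha2 w + u\<^sup>2 * tcoef_b w = w\<^sup>2 * u ^ 3 * q ^ 3 * ratio\<^sup>2"
    by (simp add: power2_eq_square power3_eq_cube mult_ac)
qed

lemma coef_a_eq: "coef_a w = - (u * s * (p + q - 2 * u))"
proof -
  have "coef_a w = 2 * (u * s) * u - u * s * (p + q)"
    using middle_coef_eq[of w, folded u_eq] char[folded s_def] unfolding coef_eq by simp
  then show ?thesis by (simp add: algebra_simps)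
qed

lemma C_eq:
  "C3 w (alpha1 w) = u * s * (1 - 2 * u * p)"
  "C6 w (alpha1 w) = (u * s * (1 - u * p))\<^sup>2" "C6 w (alpha2 w) = (u * s * (1 - u * q))\<^sup>2"
  "C7 w (alpha1 w) = tau_0 w * (1 - 2 * u * p) - 2 * u\<^sup>2 * s * p\<^sup>2"
  "C7 w (alpha2 w) = tau_0 w * (1 - 2 * u * q) - 2 * u\<^sup>2 * s * q\<^sup>2"
  unfolding alpha_eq
  by (rule C3_eq[of w p q, folded u_eq s_eq, OF root_pair_axioms]
      C6_eq[of w p q, folded u_eq s_eq, OF root_pair_axioms]
      C6_eq[of w q p, folded u_eq s_eq, OF sw.root_pair_axioms]
      C7_eq[of w p q, folded u_eq s_eq, OF root_pair_axioms]
      C7_eq[of w q p, folded u_eq s_eq, OF sw.root_pair_axioms])+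

lemma corner_coef_1:
  "w\<^sup>2 * u\<^sup>2 * (alpha1 w - alpha2 w) / (tau_m1 w * (tcoef_a w * alpha1 w + u\<^sup>2 * tcoef_b w))
    = q ^ 3 * ratio\<^sup>2 * (p - q) / (u * s)"
  unfolding den_alpha unfolding alpha_eq coef_eq using nonzero
  by (simp add: field_simps power2_eq_square power3_eq_cube)

lemma corner_coef_2:
  "(ttau_m2 w * ((1 + 2 * w) ^ 2 * u ^ 4 - 1) + ttau_m1 w * tau_1s w) * (alpha1 w - alpha2 w)
      / (tau_m1 w ^ 2 * (tcoef_a w * alpha1 w + u\<^sup>2 * tcoef_b w))
    = - (q ^ 3 * ratio\<^sup>2 * (p - q) * (p + q - 2 * u) / (u * s))"
proof -
  have E: "ttau_m2 w * ((1 + 2 * w) ^ 2 * u ^ 4 - 1) + ttau_m1 w * tau_1s w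
    = w\<^sup>2 * u\<^sup>2 * (- (u * s * (p + q - 2 * u)))"
    using alpha_numerator_eq[of w, folded u_eq] unfolding coef_a_eq .
  show ?thesis unfolding den_alpha E unfolding alpha_eq coef_eq using nonzero
    by (simp add: field_simps power2_eq_square power3_eq_cube)
qed

lemma signed_power:
  "(- 1) ^ (n + 1) * x * (- (u / alpha1 w)) ^ (n - 2) = - (x * q ^ (n - 2))"
  "(- 1) ^ (n + 2) * x * (- (u / alpha1 w)) ^ (n - 2) = x * q ^ (n - 2)"
  "(- 1) ^ (n - 3) * x * (- (u / alpha1 w)) ^ (n - 2) = - (x * q ^ (n - 2))"
proof -
  have q: "- (u / alpha1 w) = - 1 * q"
    unfolding alpha_eq p_inverse using nonzero by simp
  obtain m where n: "n = m + 3" using n_ge that[of "n - 3"] by simp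
  have "(- 1) ^ m * (- 1) ^ m = (1 :: real)" by (simp flip: power_mult_distrib)
  then show "(- 1) ^ (n + 1) * x * (- (u / alpha1 w)) ^ (n - 2) = - (x * q ^ (n - 2))"
    "(- 1) ^ (n + 2) * x * (- (u / alpha1 w)) ^ (n - 2) = x * q ^ (n - 2)"
    "(- 1) ^ (n - 3) * x * (- (u / alpha1 w)) ^ (n - 2) = - (x * q ^ (n - 2))"
    unfolding q power_mult_distrib n by (simp_all add: power_add mult_ac)
qed

lemma q_split: "q ^ (n + 1) = q ^ 3 * q ^ (n - 2)"
  using n_ge by (simp flip: power_add)

lemma column_1_alpha:
  "column n 1 = (- 1) ^ (n + 1)
    * (w\<^sup>2 * u\<^sup>2 * (alpha1 w - alpha2 w) / (tau_m1 w * (tcoef_a w * alpha1 w + u\<^sup>2 * tcoef_b w)))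
    * (- (u / alpha1 w)) ^ (n - 2)"
  unfolding signed_power corner_coef_1 column_1[OF n_ge nonzero(2)] q_split by simp

lemma column_2_alpha:
  "column n 2 = (- 1) ^ (n + 2)
    * ((ttau_m2 w * ((1 + 2 * w) ^ 2 * u ^ 4 - 1) + ttau_m1 w * tau_1s w) * (alpha1 w - alpha2 w)
      / (tau_m1 w ^ 2 * (tcoef_a w * alpha1 w + u\<^sup>2 * tcoef_b w)))
    * (- (u / alpha1 w)) ^ (n - 2)"
  unfolding signed_power corner_coef_2 column_2[OF n_ge nonzero(2)] q_split by simp

text \<open>
  All signs cancel to one minus sign, and of the powers of \<open>t\<close> there remains \<open>t\<^sup>-\<^sup>3\<close>, independently of \<open>i\<close>.
\<close>
lemma power_quotient:
  assumes "3 \<le> i" "i \<le> n - 2" "t \<noteq> 0"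
  shows "(- 1) ^ (n + i) * C * t ^ (n - i - 2) * Y * (- (t * x)) ^ (i - 3)
      / (D * (- (t * p)) ^ (n - 2))
    = - (C * Y * x ^ (i - 3) * q ^ (n - 2) / (D * t ^ 3))"
proof -
  obtain k where i: "i = k + 3" using assms(1) that[of "i - 3"] by simp
  have "k + 5 \<le> n" using assms(1,2) n_ge unfolding i by linarith
  then obtain j where n: "n = k + j + 5" using that[of "n - (k + 5)"] by simp
  have t: "- (t * z) = - 1 * t * z" for z by simp
  have e: "n + i = (k + j + 3) + (k + 5)" "n - i - 2 = j" "i - 3 = k" "n - 2 = k + j + 3"
    unfolding i n by simp_all
  have "t ^ (k + j + 3) = t ^ j * t ^ k * t ^ 3" by (simp add: power_add mult_ac)
  then show ?thesis unfolding e t power_mult_distrib p_inverse power_add[of "- 1" "k + j + 3"]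
    using assms(3) nonzero(3) by (cases "even k") (simp_all add: power_divide mult_ac)
qed

lemma column_interior_alpha:
  assumes "3 \<le> i" "i \<le> n - 2"
  defines "z \<equiv> - (coef_b w + tau_m1 w * u)"
  shows "column n i
    = (- 1) ^ (n + i) * C6 w (alpha1 w) * tau_m1 w ^ (n - i - 2) * (z * alpha1 w) ^ (i - 3)
        / (z * alpha1 w) ^ (n - 2)
    - (- 1) ^ (n + i) * C6 w (alpha2 w) * tau_m1 w ^ (n - i - 2)
        * (tcoef_a w * alpha2 w + u\<^sup>2 * tcoef_b w) * (z * alpha2 w) ^ (i - 3)
        / ((tcoef_a w * alpha1 w + u\<^sup>2 * tcoef_b w) * (z * alpha1 w) ^ (n - 2))"
proof -
  have z: "z * alpha1 w = - (u * s * p)" "z * alpha2 w = - (u * s * q)"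
    unfolding z_def coef_eq(2) alpha_eq by simp_all
  have t: "u * s \<noteq> 0" using nonzero by simp
  have first: "(- 1) ^ (n + i) * (u * s * (1 - u * p))\<^sup>2 * (u * s) ^ (n - i - 2) * (- (u * s * p)) ^ (i - 3)
      / (- (u * s * p)) ^ (n - 2) = - (q ^ (n + 1) * (1 - u * p)\<^sup>2 / (u * s) * p ^ i)"
  proof -
    have i: "p ^ i = p ^ 3 * p ^ (i - 3)" using assms by (simp flip: power_add)
    have "q ^ (n + 1) * p ^ i = (q ^ 3 * p ^ 3) * p ^ (i - 3) * q ^ (n - 2)"
      unfolding q_split i by (simp only: mult_ac)
    then have qp: "q ^ (n + 1) * p ^ i = p ^ (i - 3) * q ^ (n - 2)" unfolding power_inverse by simp
    have "(- 1) ^ (n + i) * (u * s * (1 - u * p))\<^sup>2 * (u * s) ^ (n - i - 2) * (- (u * s * p)) ^ (i - 3)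
        / (- (u * s * p)) ^ (n - 2)
      = - ((u * s * (1 - u * p))\<^sup>2 * (p ^ (i - 3) * q ^ (n - 2)) / (u * s) ^ 3)"
      using power_quotient[OF assms(1,2) t, of "(u * s * (1 - u * p))\<^sup>2" 1 p 1] by simp
    also have "(u * s * (1 - u * p))\<^sup>2 * (p ^ (i - 3) * q ^ (n - 2)) / (u * s) ^ 3
      = (1 - u * p)\<^sup>2 * (q ^ (n + 1) * p ^ i) / (u * s)"
      unfolding qp power_mult_distrib[of "u * s"] using t by (simp add: power2_eq_square power3_eq_cube)
    finally show ?thesis by (simp add: mult_ac)
  qed
  have second: "(- 1) ^ (n + i) * (u * s * (1 - u * q))\<^sup>2 * (u * s) ^ (n - i - 2)
      * (w\<^sup>2 * u ^ 3 * q ^ 3 * ratio\<^sup>2) * (- (u * s * q)) ^ (i - 3)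
      / (w\<^sup>2 * u ^ 3 / (q ^ 3 * ratio\<^sup>2) * (- (u * s * p)) ^ (n - 2))
    = - (q ^ (n + 1) * (1 - u * p)\<^sup>2 / (u * s) * (q ^ i * ratio\<^sup>2))"
  proof -
    have i: "q ^ i = q ^ 3 * q ^ (i - 3)" using assms by (simp flip: power_add)
    have r: "(1 - u * p)\<^sup>2 = ratio\<^sup>2 * (1 - u * q)\<^sup>2"
      using one_minus_uq_gt_1 by (simp add: ratio_def power_divide)
    have x: "(u * s * c)\<^sup>2 * (W * A) * x * y / (W / A * (u * s) ^ 3) = A\<^sup>2 * c\<^sup>2 * x * y / (u * s)"
      if "W \<noteq> 0" "A \<noteq> 0" for c W A x y
      using that nonzero by (simp add: field_simps power2_eq_square power3_eq_cube)
    have W: "w\<^sup>2 * u ^ 3 \<noteq> 0" and A: "q ^ 3 * ratio\<^sup>2 \<noteq> 0" using nonzero by simp_all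
    show ?thesis unfolding power_quotient[OF assms(1,2) t] unfolding i q_split r
      using x[OF W A, of "1 - u * q" "q ^ (i - 3)" "q ^ (n - 2)"]
      by (simp add: mult_ac power2_eq_square power3_eq_cube)
  qed
  show ?thesis
    unfolding column_interior[OF n_ge nonzero(2) assms(1,2)] C_eq den_alpha z
    unfolding coef_eq(1) first second by (simp add: right_diff_distrib)
qed

lemma column_n_alpha:
  "column n n = - (1 / ((coef_b w + tau_m1 w * u) * alpha1 w)) * (1 - q ^ (2 * n) * ratio ^ 4)"
proof -
  have "1 / (s * (u * p)) = q / (u * s)"
    using nonzero prod by (simp add: field_simps)
  then show ?thesis unfolding column_n[OF n_ge nonzero(2)] coef_eq(2) alpha_eq by simp
qed

lemma leading_alpha_square: "(- (coef_b w + tau_m1 w * u) * alpha1 w) ^ 2 = (u * s)\<^sup>2 / q\<^sup>2"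
proof -
  have "(- s * (u * p)) ^ 2 = (u * s)\<^sup>2 * p\<^sup>2" by (simp add: power_mult_distrib)
  also have "\<dots> = (u * s)\<^sup>2 / q\<^sup>2" using nonzero power_inverse(1)[of 2] by (simp add: field_simps)
  finally show ?thesis unfolding coef_eq(2) alpha_eq .
qed

lemma column_pred_alpha:
  "column n (n - 1) = - (C3 w (alpha1 w) / (- (coef_b w + tau_m1 w * u) * alpha1 w) ^ 2)
    * (1 - q ^ (2 * n - 2) * ratio ^ 4 * ((1 - 2 * u * q) / (1 - 2 * u * p)))"
proof -
  have nz: "1 - 2 * u * p \<noteq> 0" using one_minus_up_gt_1 by simp
  have C: "C3 w (alpha1 w) / (- (coef_b w + tau_m1 w * u) * alpha1 w) ^ 2 = q\<^sup>2 / (u * s) * (1 - 2 * u * p)"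
    unfolding C_eq leading_alpha_square using nonzero by (simp add: power2_eq_square)
  have factor: "A - Z * B = A * (1 - Z * (B / A))" if "A \<noteq> 0" for A B Z :: real
    using that by (simp add: algebra_simps)
  show ?thesis unfolding column_pred[OF n_ge nonzero(2)] C by (simp add: factor[OF nz])
qed

lemma penultimate_corner:
  "R_inv \<theta> n 2 (n - 1) * (1 - defect n) = (- 1) ^ (n - 3)
    * (tau_0 w * (ttau_m2 w * ((1 + 2 * w) ^ 2 * u ^ 4 - 1) + ttau_m1 w * tau_1s w) * (alpha1 w - alpha2 w)
      / (tau_m1 w ^ 3 * (tcoef_a w * alpha1 w + u\<^sup>2 * tcoef_b w)))
    * (- (u / alpha1 w)) ^ (n - 2)"
proof -
  have t: "tau_m1 w \<noteq> 0" unfolding coef_eq(1) using nonzero by simp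
  have i: "1 \<le> (2::nat)" "2 \<le> n" using n_ge by auto
  have "tau_m1 w * R_inv \<theta> n 2 (n - 1) = - tau_0 w * R_inv \<theta> n 2 n"
    using penultimate_column[OF i] n_ge by (auto simp: stencil_def)
  then have "R_inv \<theta> n 2 (n - 1) = - (tau_0 w / tau_m1 w * R_inv \<theta> n 2 n)"
    using t by (simp add: field_simps)
  then have "R_inv \<theta> n 2 (n - 1) * (1 - defect n) = - (tau_0 w / tau_m1 w * column n 2)"
    by (simp flip: last_column[OF i])
  then show ?thesis unfolding column_2_alpha signed_power
    by (simp add: mult.assoc power2_eq_square power3_eq_cube)
qed

text \<open>
  With \<open>Z = q\<^sup>2\<^sup>n ratio\<^sup>4\<close> both sides are of the form \<open>A - B Z\<close>, where \<open>B\<close> arises from \<open>A\<close> by the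
  exchange of \<open>p\<close> and \<open>q\<close> and multiplication by \<open>q\<^sup>2\<close>.
\<close>
lemma penultimate_diagonal:
  "R_inv \<theta> n (n - 1) (n - 1) * (1 - defect n)
    = C7 w (alpha1 w) / (- (coef_b w + tau_m1 w * u) * alpha1 w) ^ 2
      - C7 w (alpha2 w) * (tcoef_a w * alpha2 w + u\<^sup>2 * tcoef_b w)
        / ((tcoef_a w * alpha1 w + u\<^sup>2 * tcoef_b w) * (- (coef_b w + tau_m1 w * u) * alpha1 w) ^ 2)
        * (alpha2 w / alpha1 w) ^ (n - 4)" (is "?R * _ = ?f")
proof -
  define Z where "Z = q ^ (2 * n) * ratio ^ 4"
  define t where "t = u * s"
  have t: "t \<noteq> 0" using nonzero by (simp add: t_def)
  have i: "1 \<le> n - 1" "n - 1 \<le> n" using n_ge by auto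
  have "t * ?R = - 2 * u - tau_0 w * R_inv \<theta> n (n - 1) n"
    using penultimate_column[OF i] n_ge unfolding coef_eq(1) t_def[symmetric] by (auto simp: stencil_def)
  then have "(t * ?R) * (1 - defect n) = (- 2 * u - tau_0 w * R_inv \<theta> n (n - 1) n) * (1 - defect n)"
    by (rule arg_cong)
  then have "t * (?R * (1 - defect n))
    = - 2 * u * (1 - defect n) - tau_0 w * (R_inv \<theta> n (n - 1) n * (1 - defect n))"
    by (simp only: left_diff_distrib mult.assoc)
  also have "\<dots> = - 2 * u * (1 - q\<^sup>2 * Z) + tau_0 w * (q\<^sup>2 * (1 - 2 * u * p) - Z * (1 - 2 * u * q)) / t"
  proof -
    have "2 * n = 2 + (2 * n - 2)" using n_ge by simp
    then have "q ^ (2 * n) = q\<^sup>2 * q ^ (2 * n - 2)" by (metis power_add)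
    then have "q\<^sup>2 * q ^ (2 * n - 2) * ratio ^ 4 = Z" by (simp add: Z_def)
    moreover have merge: "- (Q / t) * (A - Y * R * B) = - ((Q * A - (Q * Y * R) * B) / t)" for Q A Y R B
      by (simp add: algebra_simps diff_divide_distrib add_divide_distrib)
    ultimately have "column n (n - 1) = - ((q\<^sup>2 * (1 - 2 * u * p) - Z * (1 - 2 * u * q)) / t)"
      unfolding column_pred[OF n_ge nonzero(2)] t_def[symmetric] using merge by metis
    moreover have "defect n = q\<^sup>2 * Z" by (simp add: defect_def Z_def power_add power2_eq_square)
    ultimately show ?thesis unfolding last_column[OF i] by simp
  qed
  finally have "?R * (1 - defect n)
    = (- 2 * u * (1 - q\<^sup>2 * Z) + tau_0 w * (q\<^sup>2 * (1 - 2 * u * p) - Z * (1 - 2 * u * q)) / t) / t"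
    using t by (simp add: field_simps)
  also have "\<dots> = (tau_0 w * (1 - 2 * u * p) * q\<^sup>2 - 2 * u * t) / t\<^sup>2
      - Z * (tau_0 w * (1 - 2 * u * q) - 2 * u * t * q\<^sup>2) / t\<^sup>2"
    using t by (simp add: field_simps power2_eq_square)
  also have "\<dots> = ?f"
  proof -
    have D: "A * (tcoef_a w * alpha2 w + u\<^sup>2 * tcoef_b w) / ((tcoef_a w * alpha1 w + u\<^sup>2 * tcoef_b w) * B)
      = A * (q ^ 6 * ratio ^ 4) / B" for A B
    proof -
      have "A * (W * Q) / (W / Q * B) = A * Q\<^sup>2 / B" if "W \<noteq> 0" "Q \<noteq> 0" for W Q
        using that by (simp add: field_simps power2_eq_square)
      from this[of "w\<^sup>2 * u ^ 3" "q ^ 3 * ratio\<^sup>2"] show ?thesis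
        unfolding den_alpha using nonzero by (simp add: power_mult_distrib mult_ac flip: power_mult)
    qed
    have "alpha2 w / alpha1 w = q\<^sup>2"
      unfolding alpha_eq p_inverse using nonzero by (simp add: power2_eq_square)
    then have qq: "(alpha2 w / alpha1 w) ^ (n - 4) = q ^ (2 * (n - 4))" by (simp add: power_mult)
    have "6 + 2 * (n - 4) + 2 = 2 * n" using n_ge by simp
    then have "q ^ 6 * q ^ (2 * (n - 4)) * q\<^sup>2 = q ^ (2 * n)" by (metis power_add)
    then have ZZ: "q ^ 6 * ratio ^ 4 * q ^ (2 * (n - 4)) * q\<^sup>2 = Z"
      by (simp add: Z_def mult_ac)
    have c1: "(tau_0 w * (1 - 2 * u * p) - 2 * u\<^sup>2 * s * p\<^sup>2) * q\<^sup>2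
      = tau_0 w * (1 - 2 * u * p) * q\<^sup>2 - 2 * u * t"
    proof -
      have "(tau_0 w * (1 - 2 * u * p) - 2 * u\<^sup>2 * s * p\<^sup>2) * q\<^sup>2
        = tau_0 w * (1 - 2 * u * p) * q\<^sup>2 - 2 * u\<^sup>2 * s * (p\<^sup>2 * q\<^sup>2)" by (simp add: algebra_simps)
      then show ?thesis unfolding power_inverse by (simp add: t_def power2_eq_square)
    qed
    have c2: "2 * u\<^sup>2 * s * q\<^sup>2 = 2 * u * t * q\<^sup>2" by (simp add: t_def power2_eq_square)
    have "?f = (tau_0 w * (1 - 2 * u * p) - 2 * u\<^sup>2 * s * p\<^sup>2) * q\<^sup>2 / t\<^sup>2
      - (q ^ 6 * ratio ^ 4 * q ^ (2 * (n - 4)) * q\<^sup>2) * (tau_0 w * (1 - 2 * u * q) - 2 * u\<^sup>2 * s * q\<^sup>2) / t\<^sup>2"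
      unfolding D leading_alpha_square t_def[symmetric] qq C_eq by (simp add: mult_ac)
    then show ?thesis unfolding ZZ c1 c2 by simp
  qed
  finally show ?thesis .
qed

end

section \<open>Error terms and the theorem\<close>

context scaled_roots
begin

text \<open>
  The relative error is \<open>(\<delta> - \<eta>) / (1 - \<delta>)\<close> with \<open>\<delta> = defect n \<le> 1 / 2\<close>, so it is at most
  \<open>2 \<rho>\<^bsup>n-3\<^esup>\<close>. The weakest of the bounds on \<open>\<eta>\<close> needed below, that for the entry \<open>(n - 1, n)\<close>,
  fixes the exponent \<open>n - 3\<close>.
\<close>
lemma relative_error:
  assumes "R * (1 - defect n) = f * (1 - \<eta>)" "0 \<le> \<eta>" "\<eta> \<le> rho ^ (n - 3)"
  shows "\<exists>\<epsilon>. \<bar>\<epsilon>\<bar> \<le> 2 / rho ^ 3 * rho ^ n \<and> R = f * (1 + \<epsilon>)"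
proof (intro exI conjI)
  have d: "1 / 2 \<le> 1 - defect n" using defect_bounds by simp
  have "rho ^ (n - 1) \<le> rho ^ (n - 3)" using rho_bounds by (intro power_decreasing) auto
  then have "\<bar>defect n - \<eta>\<bar> \<le> rho ^ (n - 3)" using assms defect_bounds by linarith
  then have "\<bar>(defect n - \<eta>) / (1 - defect n)\<bar> \<le> rho ^ (n - 3) / (1 / 2)"
    unfolding abs_divide using d by (intro frac_le) auto
  also have "rho ^ n = rho ^ 3 * rho ^ (n - 3)" using n_ge by (simp flip: power_add)
  then have "rho ^ (n - 3) / (1 / 2) = 2 / rho ^ 3 * rho ^ n" using rho_bounds by simp
  finally show "\<bar>(defect n - \<eta>) / (1 - defect n)\<bar> \<le> 2 / rho ^ 3 * rho ^ n" .
  have "1 + (defect n - \<eta>) / (1 - defect n) = (1 - \<eta>) / (1 - defect n)"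
    using d by (simp add: field_simps)
  moreover have "R = f * (1 - \<eta>) / (1 - defect n)"
    using assms(1) d by (subst eq_divide_eq) auto
  ultimately show "R = f * (1 + (defect n - \<eta>) / (1 - defect n))" by simp
qed

lemma relative_error_exact:
  assumes "R * (1 - defect n) = f"
  shows "\<exists>\<epsilon>. \<bar>\<epsilon>\<bar> \<le> 2 / rho ^ 3 * rho ^ n \<and> R = f * (1 + \<epsilon>)"
  using relative_error[of R f 0] assms rho_bounds by simp

lemma relative_error_diff:
  assumes "R * (1 - defect n) = f - g"
  shows "\<exists>\<epsilon> \<epsilon>'. \<bar>\<epsilon>\<bar> \<le> 2 / rho ^ 3 * rho ^ n \<and> \<bar>\<epsilon>'\<bar> \<le> 2 / rho ^ 3 * rho ^ n
    \<and> R = f * (1 + \<epsilon>) - g * (1 + \<epsilon>')"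
proof -
  obtain \<epsilon> where \<epsilon>: "\<bar>\<epsilon>\<bar> \<le> 2 / rho ^ 3 * rho ^ n" "1 / (1 - defect n) = 1 * (1 + \<epsilon>)"
    using relative_error_exact[of "1 / (1 - defect n)" 1] defect_bounds by auto
  have "R = (f - g) * (1 / (1 - defect n))" using assms defect_bounds by (simp add: eq_divide_eq)
  also have "\<dots> = f * (1 + \<epsilon>) - g * (1 + \<epsilon>)" unfolding \<epsilon>(2) by (simp add: algebra_simps)
  finally show ?thesis using \<epsilon>(1) by blast
qed

lemma column_n_defect_bound: "q ^ (2 * n) * ratio ^ 4 \<le> rho ^ (n - 3)"
proof -
  have "q ^ (2 * n) * ratio ^ 4 \<le> rho ^ (n - 2)" using tail_le[of n] n_ge by simp
  also have "\<dots> \<le> rho ^ (n - 3)" using rho_bounds by (intro power_decreasing) auto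
  finally show ?thesis .
qed

lemma column_pred_defect_bound:
  "0 \<le> q ^ (2 * n - 2) * ratio ^ 4 * ((1 - 2 * u * q) / (1 - 2 * u * p))"
  "q ^ (2 * n - 2) * ratio ^ 4 * ((1 - 2 * u * q) / (1 - 2 * u * p)) \<le> rho ^ (n - 3)"
proof -
  have e: "2 * n - 2 = 2 * (n - 1)" by simp
  have "p \<le> q" using alpha_root_pair(2)[OF pos(1)] by (simp add: u_eq p_eq q_eq)
  then have "u * p \<le> u * q" using pos by simp
  moreover have "1 - 2 * u * p > 0" "1 - 2 * u * q > 0" using one_minus_up_gt_1 one_minus_uq_gt_1 by simp_all
  ultimately have f: "0 \<le> (1 - 2 * u * q) / (1 - 2 * u * p)" "(1 - 2 * u * q) / (1 - 2 * u * p) \<le> 1"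
    by simp_all
  show "0 \<le> q ^ (2 * n - 2) * ratio ^ 4 * ((1 - 2 * u * q) / (1 - 2 * u * p))"
    unfolding e by (intro mult_nonneg_nonneg[OF tail_nonneg f(1)])
  have "q ^ (2 * n - 2) * ratio ^ 4 * ((1 - 2 * u * q) / (1 - 2 * u * p)) \<le> q ^ (2 * n - 2) * ratio ^ 4"
    unfolding e using mult_left_mono[OF f(2) tail_nonneg[of "n - 1"]] by simp
  also have "\<dots> \<le> rho ^ (n - 3)" unfolding e using tail_le[of "n - 1"] n_ge by (simp add: numeral_3_eq_3)
  finally show "q ^ (2 * n - 2) * ratio ^ 4 * ((1 - 2 * u * q) / (1 - 2 * u * p)) \<le> rho ^ (n - 3)" .
qed

text \<open>
  The reflection \<open>i \<mapsto> n + 1 - i\<close> turns exponents and sign of the last column into those of the first.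
\<close>
lemma reflect_index:
  assumes "i \<in> {3..n - 2}"
  shows "1 \<le> i" "i \<le> n" "3 \<le> i" "i \<le> n - 2" "3 \<le> n + 1 - i" "n + 1 - i \<le> n - 2"
    "n - (n + 1 - i) - 2 = i - 3" "n + 1 - i - 3 = n - i - 2"
    "(- 1 :: real) ^ (n + (n + 1 - i)) = (- 1) ^ (i + 1)"
proof -
  show i: "1 \<le> i" "i \<le> n" "3 \<le> i" "i \<le> n - 2" "3 \<le> n + 1 - i" "n + 1 - i \<le> n - 2"
    "n - (n + 1 - i) - 2 = i - 3" "n + 1 - i - 3 = n - i - 2"
    using assms n_ge by auto
  have "even (n + (n + 1 - i)) = even (i + 1)" using i(1,2) by presburger
  then show "(- 1 :: real) ^ (n + (n + 1 - i)) = (- 1) ^ (i + 1)"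
    by (simp add: minus_one_power_iff)
qed

lemma invertible: "invertible_mat (R_mat \<theta> n)"
  by (rule inverse_exists) (rule R_mat_invertible)

lemma entry_2_pred:
  "\<exists>\<epsilon>. \<bar>\<epsilon>\<bar> \<le> 2 / rho ^ 3 * rho ^ n \<and> R_inv \<theta> n 2 (n - 1) = (- 1) ^ (n - 3)
    * (tau_0 w * (ttau_m2 w * ((1 + 2 * w) ^ 2 * u ^ 4 - 1) + ttau_m1 w * tau_1s w) * (alpha1 w - alpha2 w)
      / (tau_m1 w ^ 3 * (tcoef_a w * alpha1 w + u ^ 2 * tcoef_b w)))
    * (- (u / alpha1 w)) ^ (n - 2) * (1 + \<epsilon>)"
  by (rule relative_error_exact[OF penultimate_corner])

lemma entry_pred_pred:
  "\<exists>\<epsilon>. \<bar>\<epsilon>\<bar> \<le> 2 / rho ^ 3 * rho ^ n \<and> R_inv \<theta> n (n - 1) (n - 1) =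
    (C7 w (alpha1 w) / (- (coef_b w + tau_m1 w * u) * alpha1 w) ^ 2
      - C7 w (alpha2 w) * (tcoef_a w * alpha2 w + u ^ 2 * tcoef_b w)
        / ((tcoef_a w * alpha1 w + u ^ 2 * tcoef_b w) * (- (coef_b w + tau_m1 w * u) * alpha1 w) ^ 2)
        * (alpha2 w / alpha1 w) ^ (n - 4)) * (1 + \<epsilon>)"
  by (rule relative_error_exact[OF penultimate_diagonal])

lemma entry_1_n:
  "\<exists>\<epsilon>. \<bar>\<epsilon>\<bar> \<le> 2 / rho ^ 3 * rho ^ n \<and> R_inv \<theta> n 1 n = (- 1) ^ (n + 1)
    * (w ^ 2 * u ^ 2 * (alpha1 w - alpha2 w) / (tau_m1 w * (tcoef_a w * alpha1 w + u ^ 2 * tcoef_b w)))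
    * (- (u / alpha1 w)) ^ (n - 2) * (1 + \<epsilon>)"
  using n_ge by (intro relative_error_exact) (simp only: last_column column_1_alpha)

lemma entry_2_n:
  "\<exists>\<epsilon>. \<bar>\<epsilon>\<bar> \<le> 2 / rho ^ 3 * rho ^ n \<and> R_inv \<theta> n 2 n = (- 1) ^ (n + 2)
    * ((ttau_m2 w * ((1 + 2 * w) ^ 2 * u ^ 4 - 1) + ttau_m1 w * tau_1s w) * (alpha1 w - alpha2 w)
      / (tau_m1 w ^ 2 * (tcoef_a w * alpha1 w + u ^ 2 * tcoef_b w)))
    * (- (u / alpha1 w)) ^ (n - 2) * (1 + \<epsilon>)"
  by (rule relative_error_exact, subst last_column) (use n_ge column_2_alpha in auto)

lemma entry_pred_1:
  "\<exists>\<epsilon>. \<bar>\<epsilon>\<bar> \<le> 2 / rho ^ 3 * rho ^ n \<and> R_inv \<theta> n (n - 1) 1 = (- 1) ^ (n + 2)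
    * ((ttau_m2 w * ((1 + 2 * w) ^ 2 * u ^ 4 - 1) + ttau_m1 w * tau_1s w) * (alpha1 w - alpha2 w)
      / (tau_m1 w ^ 2 * (tcoef_a w * alpha1 w + u ^ 2 * tcoef_b w)))
    * (- (u / alpha1 w)) ^ (n - 2) * (1 + \<epsilon>)"
proof (rule relative_error_exact)
  have "n + 1 - (n - 1) = 2" using n_ge by simp
  then show "R_inv \<theta> n (n - 1) 1 * (1 - defect n) = (- 1) ^ (n + 2)
    * ((ttau_m2 w * ((1 + 2 * w) ^ 2 * u ^ 4 - 1) + ttau_m1 w * tau_1s w) * (alpha1 w - alpha2 w)
      / (tau_m1 w ^ 2 * (tcoef_a w * alpha1 w + u ^ 2 * tcoef_b w)))
    * (- (u / alpha1 w)) ^ (n - 2)"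
    using first_column[of "n - 1"] n_ge unfolding column_2_alpha[symmetric] by simp
qed

lemma entry_n_n:
  "\<exists>\<epsilon>. \<bar>\<epsilon>\<bar> \<le> 2 / rho ^ 3 * rho ^ n \<and>
    R_inv \<theta> n n n = - (1 / ((coef_b w + tau_m1 w * u) * alpha1 w)) * (1 + \<epsilon>)"
  using last_column[of n, unfolded column_n_alpha] n_ge
  by (intro relative_error[OF _ tail_nonneg column_n_defect_bound]) auto

lemma entry_1_1:
  "\<exists>\<epsilon>. \<bar>\<epsilon>\<bar> \<le> 2 / rho ^ 3 * rho ^ n \<and>
    R_inv \<theta> n 1 1 = - (1 / ((coef_b w + tau_m1 w * u) * alpha1 w)) * (1 + \<epsilon>)"
proof (rule relative_error[OF _ tail_nonneg column_n_defect_bound])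
  show "R_inv \<theta> n 1 1 * (1 - defect n)
    = - (1 / ((coef_b w + tau_m1 w * u) * alpha1 w)) * (1 - q ^ (2 * n) * ratio ^ 4)"
    unfolding column_n_alpha[symmetric] using first_column[of 1] n_ge by simp
qed

lemma entry_pred_n:
  "\<exists>\<epsilon>. \<bar>\<epsilon>\<bar> \<le> 2 / rho ^ 3 * rho ^ n \<and> R_inv \<theta> n (n - 1) n =
    - (C3 w (alpha1 w) / (- (coef_b w + tau_m1 w * u) * alpha1 w) ^ 2) * (1 + \<epsilon>)"
  using last_column[of "n - 1", unfolded column_pred_alpha] n_ge
  by (intro relative_error[OF _ column_pred_defect_bound]) auto

lemma entry_2_1:
  "\<exists>\<epsilon>. \<bar>\<epsilon>\<bar> \<le> 2 / rho ^ 3 * rho ^ n \<and> R_inv \<theta> n 2 1 =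
    - (C3 w (alpha1 w) / (- (coef_b w + tau_m1 w * u) * alpha1 w) ^ 2) * (1 + \<epsilon>)"
proof (rule relative_error[OF _ column_pred_defect_bound])
  have "n + 1 - 2 = n - 1" by simp
  then show "R_inv \<theta> n 2 1 * (1 - defect n)
    = - (C3 w (alpha1 w) / (- (coef_b w + tau_m1 w * u) * alpha1 w) ^ 2)
      * (1 - q ^ (2 * n - 2) * ratio ^ 4 * ((1 - 2 * u * q) / (1 - 2 * u * p)))"
    unfolding column_pred_alpha[symmetric] using first_column[of 2] n_ge by simp
qed

lemma entry_interior_n:
  assumes "i \<in> {3..n - 2}"
  shows "\<exists>\<epsilon> \<epsilon>'. \<bar>\<epsilon>\<bar> \<le> 2 / rho ^ 3 * rho ^ n \<and> \<bar>\<epsilon>'\<bar> \<le> 2 / rho ^ 3 * rho ^ n \<and> R_inv \<theta> n i n =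
    (- 1) ^ (n + i) * C6 w (alpha1 w) * tau_m1 w ^ (n - i - 2)
        * (- (coef_b w + tau_m1 w * u) * alpha1 w) ^ (i - 3)
        / (- (coef_b w + tau_m1 w * u) * alpha1 w) ^ (n - 2) * (1 + \<epsilon>)
    - (- 1) ^ (n + i) * C6 w (alpha2 w) * tau_m1 w ^ (n - i - 2)
        * (tcoef_a w * alpha2 w + u ^ 2 * tcoef_b w) * (- (coef_b w + tau_m1 w * u) * alpha2 w) ^ (i - 3)
        / ((tcoef_a w * alpha1 w + u ^ 2 * tcoef_b w)
          * (- (coef_b w + tau_m1 w * u) * alpha1 w) ^ (n - 2)) * (1 + \<epsilon>')"
  by (rule relative_error_diff)
     (simp only: last_column column_interior_alpha reflect_index[OF assms])

lemma entry_interior_1: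
  assumes "i \<in> {3..n - 2}"
  shows "\<exists>\<epsilon> \<epsilon>'. \<bar>\<epsilon>\<bar> \<le> 2 / rho ^ 3 * rho ^ n \<and> \<bar>\<epsilon>'\<bar> \<le> 2 / rho ^ 3 * rho ^ n \<and> R_inv \<theta> n i 1 =
    (- 1) ^ (i + 1) * C6 w (alpha1 w) * tau_m1 w ^ (i - 3)
        * (- (coef_b w + tau_m1 w * u) * alpha1 w) ^ (n - i - 2)
        / (- (coef_b w + tau_m1 w * u) * alpha1 w) ^ (n - 2) * (1 + \<epsilon>)
    - (- 1) ^ (i + 1) * C6 w (alpha2 w) * tau_m1 w ^ (i - 3)
        * (tcoef_a w * alpha2 w + u ^ 2 * tcoef_b w) * (- (coef_b w + tau_m1 w * u) * alpha2 w) ^ (n - i - 2)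
        / ((tcoef_a w * alpha1 w + u ^ 2 * tcoef_b w)
          * (- (coef_b w + tau_m1 w * u) * alpha1 w) ^ (n - 2)) * (1 + \<epsilon>')"
  by (rule relative_error_diff)
     (simp only: first_column column_interior_alpha reflect_index[OF assms])

end

theorem theorem6:
  fixes \<beta>0 \<beta>1 :: real
  assumes "0 < \<beta>0" and "\<beta>0 < \<beta>1"
  shows "\<exists>K::real. \<forall>\<^sub>F n::nat in sequentially. \<forall>\<theta>\<in>{\<beta>0..\<beta>1}.
    invertible_mat (R_mat \<theta> n) \<and>
    (let w = \<theta> / real n; u = uw w;
         t = tau_m1 w; t0 = tau_0 w; t1 = tau_1s w;
         tt2 = ttau_m2 w; tt1 = ttau_m1 w;
         b = coef_b w; a' = tcoef_a w; b' = tcoef_b w;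
         \<alpha>1 = alpha1 w; \<alpha>2 = alpha2 w;
         C31 = C3 w \<alpha>1;
         C61 = C6 w \<alpha>1; C62 = C6 w \<alpha>2;
         C71 = C7 w \<alpha>1; C72 = C7 w \<alpha>2
     in
      (\<exists>\<epsilon>. \<bar>\<epsilon>\<bar> \<le> K * rho ^ n \<and>
        R_inv \<theta> n 2 (n - 1) =
          (-1) ^ (n - 3) *
          (t0 * (tt2 * ((1 + 2 * w) ^ 2 * u ^ 4 - 1) + tt1 * t1) * (\<alpha>1 - \<alpha>2)
             / (t ^ 3 * (a' * \<alpha>1 + u ^ 2 * b'))) *
          (- (u / \<alpha>1)) ^ (n - 2) * (1 + \<epsilon>)) \<and>
      (\<exists>\<epsilon>. \<bar>\<epsilon>\<bar> \<le> K * rho ^ n \<and>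
        R_inv \<theta> n (n - 1) (n - 1) =
          (C71 / (- (b + t * u) * \<alpha>1) ^ 2
           - C72 * (a' * \<alpha>2 + u ^ 2 * b')
               / ((a' * \<alpha>1 + u ^ 2 * b') * (- (b + t * u) * \<alpha>1) ^ 2) *
             (\<alpha>2 / \<alpha>1) ^ (n - 4)) * (1 + \<epsilon>)) \<and>
      (\<exists>\<epsilon>. \<bar>\<epsilon>\<bar> \<le> K * rho ^ n \<and>
        R_inv \<theta> n 1 n =
          (-1) ^ (n + 1) *
          (w ^ 2 * u ^ 2 * (\<alpha>1 - \<alpha>2) / (t * (a' * \<alpha>1 + u ^ 2 * b'))) *
          (- (u / \<alpha>1)) ^ (n - 2) * (1 + \<epsilon>)) \<and>
      (\<exists>\<epsilon>. \<bar>\<epsilon>\<bar> \<le> K * rho ^ n \<and>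
        R_inv \<theta> n 2 n =
          (-1) ^ (n + 2) *
          ((tt2 * ((1 + 2 * w) ^ 2 * u ^ 4 - 1) + tt1 * t1) * (\<alpha>1 - \<alpha>2)
             / (t ^ 2 * (a' * \<alpha>1 + u ^ 2 * b'))) *
          (- (u / \<alpha>1)) ^ (n - 2) * (1 + \<epsilon>)) \<and>
      (\<forall>i\<in>{3..n - 2}. \<exists>\<epsilon> \<epsilon>'. \<bar>\<epsilon>\<bar> \<le> K * rho ^ n \<and> \<bar>\<epsilon>'\<bar> \<le> K * rho ^ n \<and>
        R_inv \<theta> n i n =
          (-1) ^ (n + i) * C61 * t ^ (n - i - 2) * (- (b + t * u) * \<alpha>1) ^ (i - 3)
            / (- (b + t * u) * \<alpha>1) ^ (n - 2) * (1 + \<epsilon>)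
          - (-1) ^ (n + i) * C62 * t ^ (n - i - 2) * (a' * \<alpha>2 + u ^ 2 * b')
              * (- (b + t * u) * \<alpha>2) ^ (i - 3)
            / ((a' * \<alpha>1 + u ^ 2 * b') * (- (b + t * u) * \<alpha>1) ^ (n - 2)) * (1 + \<epsilon>')) \<and>
      (\<exists>\<epsilon>. \<bar>\<epsilon>\<bar> \<le> K * rho ^ n \<and>
        R_inv \<theta> n (n - 1) n = - (C31 / (- (b + t * u) * \<alpha>1) ^ 2) * (1 + \<epsilon>)) \<and>
      (\<exists>\<epsilon>. \<bar>\<epsilon>\<bar> \<le> K * rho ^ n \<and>
        R_inv \<theta> n n n = - (1 / ((b + t * u) * \<alpha>1)) * (1 + \<epsilon>)) \<and>
      (\<exists>\<epsilon>. \<bar>\<epsilon>\<bar> \<le> K * rho ^ n \<and>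
        R_inv \<theta> n 1 1 = - (1 / ((b + t * u) * \<alpha>1)) * (1 + \<epsilon>)) \<and>
      (\<exists>\<epsilon>. \<bar>\<epsilon>\<bar> \<le> K * rho ^ n \<and>
        R_inv \<theta> n 2 1 = - (C31 / (- (b + t * u) * \<alpha>1) ^ 2) * (1 + \<epsilon>)) \<and>
      (\<forall>i\<in>{3..n - 2}. \<exists>\<epsilon> \<epsilon>'. \<bar>\<epsilon>\<bar> \<le> K * rho ^ n \<and> \<bar>\<epsilon>'\<bar> \<le> K * rho ^ n \<and>
        R_inv \<theta> n i 1 =
          (-1) ^ (i + 1) * C61 * t ^ (i - 3) * (- (b + t * u) * \<alpha>1) ^ (n - i - 2)
            / (- (b + t * u) * \<alpha>1) ^ (n - 2) * (1 + \<epsilon>)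
          - (-1) ^ (i + 1) * C62 * t ^ (i - 3) * (a' * \<alpha>2 + u ^ 2 * b')
              * (- (b + t * u) * \<alpha>2) ^ (n - i - 2)
            / ((a' * \<alpha>1 + u ^ 2 * b') * (- (b + t * u) * \<alpha>1) ^ (n - 2)) * (1 + \<epsilon>')) \<and>
      (\<exists>\<epsilon>. \<bar>\<epsilon>\<bar> \<le> K * rho ^ n \<and>
        R_inv \<theta> n (n - 1) 1 =
          (-1) ^ (n + 2) *
          ((tt2 * ((1 + 2 * w) ^ 2 * u ^ 4 - 1) + tt1 * t1) * (\<alpha>1 - \<alpha>2)
             / (t ^ 2 * (a' * \<alpha>1 + u ^ 2 * b'))) *
          (- (u / \<alpha>1)) ^ (n - 2) * (1 + \<epsilon>)))"
proof (intro exI[of _ "2 / rho ^ 3"] eventually_sequentiallyI[of 5] ballI, goal_cases)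
  case (1 n \<theta>)
  define w where "w = \<theta> / real n"
  interpret scaled_roots \<theta> n w "uw w" "alpha1 w / uw w" "alpha2 w / uw w"
    using 1 \<open>0 < \<beta>0\<close> by unfold_locales (simp_all add: w_def)
  show ?case
    unfolding Let_def w_def[symmetric]
    by (intro conjI ballI invertible entry_2_pred entry_pred_pred entry_1_n entry_2_n entry_interior_n
        entry_pred_n entry_n_n entry_1_1 entry_2_1 entry_interior_1 entry_pred_1)
qed

end
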